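(* Let $K=K^i_j$ be a smooth gl-regular $(1,1)$-tensor field on a smooth manifold $M$ of dimension $n$, with characteristic polynomial $$\chi(t):=\det(t\operatorname{Id}-K)=t^n-\sigma_1t^{n-1}-\sigma_2t^{n-2}-\dots-\sigma_n,$$ where $\sigma_1,\dots,\sigma_n$ are smooth functions on $M$. Then $K$ is weakly nonlinear at algebraically generic points if and only if at every point of $M$ we have $$(K^* )^{n-1}d\sigma_1+(K^* )^{n-2}d\sigma_2+\dots+(K^* )^{0}d\sigma_n=0.$$
   Context: $K^*:T^*M\to T^*M$ is the operator dual to $K:TM\to TM$, i.e. $(K^*\alpha)(\xi)=\alpha(K\xi)$; $(K^* )^m$ is its $m$-fold composition with itself and $(K^* )^0=\operatorname{Id}$. A $(1,1)$-tensor field is gl-regular if at every point the geometric multiplicity of every eigenvalue (i.e. the dimension of the corresponding eigenspace) is one. A point is algebraically generic for a $(1,1)$-tensor field if in a neighbourhood of the point the Segre characteristic is constant, i.e. the eigenvalues may change, but their number and the structure (number and sizes) of the corresponding Jordan blocks remain the same. For a gl-regular $(1,1)$-tensor field this is equivalent to the number of distinct eigenvalues being constant in a neighbourhood of the point. In a neighbourhood of an algebraically generic point the eigenvalues are smooth functions. A $(1,1)$-tensor field is weakly nonlinear at algebraically generic points if at every algebraically generic point the derivative of every eigenvalue in the direction of its eigenvector is zero, i.e. $d\lambda(v)=0$ whenever $Kv=\lambda v$. Eigenvalues may be complex; in that case eigenvectors lie in the complexified tangent space and $d\lambda$ is extended complex-linearly to it. *)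

theory Defs
  imports "HOL-Analysis.Analysis" "Jordan_Normal_Form.Jordan_Normal_Form"
begin

no_notation Matrix.vec_index (infixl "$" 100)

section \<open>Smooth maps between Euclidean spaces\<close>

text \<open>
  Meant for open \<open>S\<close> only: a map is of class \<open>k + 1\<close> iff it is differentiable and all its
  directional derivatives are of class \<open>k\<close>.
\<close>

primrec Ck_on :: "nat \<Rightarrow> 'a::euclidean_space set \<Rightarrow> ('a \<Rightarrow> 'b::real_normed_vector) \<Rightarrow> bool" where
  "Ck_on 0 S f \<longleftrightarrow> continuous_on S f"
| "Ck_on (Suc k) S f \<longleftrightarrow>
     (\<forall>x\<in>S. f differentiable (at x)) \<and> (\<forall>v. Ck_on k S (\<lambda>x. frechet_derivative f (at x) v))"

definition smooth_on :: "'a::euclidean_space set \<Rightarrow> ('a \<Rightarrow> 'b::real_normed_vector) \<Rightarrow> bool" where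
  "smooth_on S f \<longleftrightarrow> (\<forall>k. Ck_on k S f)"

section \<open>Smooth manifolds\<close>

text \<open>A chart is a pair of its domain and its coordinate map; the latter is junk off the domain.\<close>

type_synonym ('a, 'n) chart = "'a set \<times> ('a \<Rightarrow> real ^ 'n)"

definition coord_repr :: "('a, 'n::finite) chart \<Rightarrow> ('a \<Rightarrow> 'b) \<Rightarrow> real ^ 'n \<Rightarrow> 'b" where
  "coord_repr c f = f \<circ> inv_into (fst c) (snd c)"

definition transition :: "('a, 'n::finite) chart \<Rightarrow> ('a, 'n) chart \<Rightarrow> real ^ 'n \<Rightarrow> real ^ 'n" where
  "transition c c' = coord_repr c (snd c')"

definition is_chart :: "'a topology \<Rightarrow> ('a, 'n::finite) chart \<Rightarrow> bool" where
  "is_chart M c \<longleftrightarrow>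
     openin M (fst c) \<and> open (snd c ` fst c) \<and>
     homeomorphic_map (subtopology M (fst c)) (top_of_set (snd c ` fst c)) (snd c)"

definition smooth_manifold :: "'a topology \<Rightarrow> ('a, 'n::finite) chart set \<Rightarrow> bool" where
  "smooth_manifold M \<A> \<longleftrightarrow>
     Hausdorff_space M \<and> second_countable M \<and>
     (\<forall>c\<in>\<A>. is_chart M c) \<and>
     (\<Union>c\<in>\<A>. fst c) = topspace M \<and>
     (\<forall>c\<in>\<A>. \<forall>c'\<in>\<A>. smooth_on (snd c ` (fst c \<inter> fst c')) (transition c c'))"

definition charts_at :: "('a, 'n::finite) chart set \<Rightarrow> 'a \<Rightarrow> ('a, 'n) chart set" where
  "charts_at \<A> p = {c \<in> \<A>. p \<in> fst c}"

definition smooth_fun_on ::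
  "('a, 'n::finite) chart set \<Rightarrow> 'a set \<Rightarrow> ('a \<Rightarrow> 'b::real_normed_vector) \<Rightarrow> bool" where
  "smooth_fun_on \<A> W f \<longleftrightarrow> (\<forall>c\<in>\<A>. smooth_on (snd c ` (fst c \<inter> W)) (coord_repr c f))"

text \<open>
  \<open>differential c f p\<close> is the covector \<open>df\<close> at \<open>p\<close>, acting on tangent vectors given by their
  components in the chart \<open>c\<close>.
\<close>

definition differential ::
  "('a, 'n::finite) chart \<Rightarrow> ('a \<Rightarrow> 'b::real_normed_vector) \<Rightarrow> 'a \<Rightarrow> real ^ 'n \<Rightarrow> 'b" where
  "differential c f p = frechet_derivative (coord_repr c f) (at (snd c p))"

definition complex_differential ::
  "('a, 'n::finite) chart \<Rightarrow> ('a \<Rightarrow> complex) \<Rightarrow> 'a \<Rightarrow> complex ^ 'n \<Rightarrow> complex" where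
  "complex_differential c f p v =
     differential c f p (\<chi> i. Re (v $ i)) + \<i> * differential c f p (\<chi> i. Im (v $ i))"

section \<open>(1,1)-tensor fields\<close>

text \<open>
  A (1,1)-tensor field is given by its component matrices: \<open>K c p $ i $ j\<close> is the component
  \<open>K^i_j\<close> at \<open>p\<close> in the chart \<open>c\<close>, so that \<open>K c p *v \<xi>\<close> is the component vector of the image
  of the tangent vector with components \<open>\<xi>\<close>.  The third conjunct below is the tensor
  transformation law.
\<close>

type_synonym ('a, 'n) tensor_field11 = "('a, 'n) chart \<Rightarrow> 'a \<Rightarrow> real ^ 'n ^ 'n"

definition smooth_tensor_field11 ::
  "('a, 'n::finite) chart set \<Rightarrow> ('a, 'n) tensor_field11 \<Rightarrow> bool" where
  "smooth_tensor_field11 \<A> K \<longleftrightarrow>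
     (\<forall>c\<in>\<A>. smooth_on (snd c ` fst c) (coord_repr c (K c))) \<and>
     (\<forall>c\<in>\<A>. \<forall>c'\<in>\<A>. \<forall>p\<in>fst c \<inter> fst c'. \<forall>\<xi>.
        K c' p *v differential c (snd c') p \<xi> = differential c (snd c') p (K c p *v \<xi>))"

definition dual_op :: "real ^ 'n ^ 'n \<Rightarrow> (real ^ 'n \<Rightarrow> real) \<Rightarrow> real ^ 'n::finite \<Rightarrow> real" where
  "dual_op A \<alpha> = (\<lambda>\<xi>. \<alpha> (A *v \<xi>))"

definition char_poly_at :: "real ^ 'n ^ 'n::finite \<Rightarrow> real \<Rightarrow> real" where
  "char_poly_at A t = Determinants.det (t *\<^sub>R Finite_Cartesian_Product.mat 1 - A)"

section \<open>Eigenvalues and Jordan structure\<close>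

abbreviation complexify :: "real ^ 'n ^ 'n \<Rightarrow> complex ^ 'n ^ 'n::finite" where
  "complexify A \<equiv> map_matrix complex_of_real A"

definition eigenspace_of :: "complex ^ 'n ^ 'n \<Rightarrow> complex \<Rightarrow> (complex ^ 'n::finite) set" where
  "eigenspace_of A l = {v. A *v v = l *s v}"

definition eigenvalues_of :: "complex ^ 'n ^ 'n::finite \<Rightarrow> complex set" where
  "eigenvalues_of A = {l. \<exists>v\<in>eigenspace_of A l. v \<noteq> 0}"

definition gl_regular ::
  "'a topology \<Rightarrow> ('a, 'n::finite) chart set \<Rightarrow> ('a, 'n) tensor_field11 \<Rightarrow> bool" where
  "gl_regular M \<A> K \<longleftrightarrow>
     (\<forall>p\<in>topspace M. \<forall>c\<in>charts_at \<A> p.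
        \<forall>l\<in>eigenvalues_of (complexify (K c p)). vec.dim (eigenspace_of (complexify (K c p)) l) = 1)"

text \<open>
  \<open>has_jordan_form A bs\<close>: \<open>A\<close> has a Jordan normal form whose blocks have the sizes and
  eigenvalues listed in \<open>bs\<close>.  The enumeration \<open>e\<close> of the index type is immaterial, since
  renumbering the basis is a similarity transformation.
\<close>

definition has_jordan_form :: "complex ^ 'n ^ 'n::finite \<Rightarrow> (nat \<times> complex) list \<Rightarrow> bool" where
  "has_jordan_form A bs \<longleftrightarrow>
     (\<exists>e. bij_betw e {..<CARD('n)} (UNIV :: 'n set) \<and>
          jordan_nf (Matrix.mat CARD('n) CARD('n) (\<lambda>(i, j). A $ e i $ e j)) bs)"

text \<open>
  The Segre characteristic collects, for each distinct eigenvalue, the multiset of the sizes of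
  its Jordan blocks; the values of the eigenvalues are forgotten.
\<close>

definition segre_of_blocks :: "(nat \<times> complex) list \<Rightarrow> nat multiset multiset" where
  "segre_of_blocks bs =
     image_mset (\<lambda>l. mset (map fst (filter (\<lambda>b. snd b = l) bs))) (mset_set (snd ` set bs))"

definition has_segre_characteristic ::
  "complex ^ 'n ^ 'n::finite \<Rightarrow> nat multiset multiset \<Rightarrow> bool" where
  "has_segre_characteristic A S \<longleftrightarrow> (\<exists>bs. has_jordan_form A bs \<and> segre_of_blocks bs = S)"

definition algebraically_generic ::
  "'a topology \<Rightarrow> ('a, 'n::finite) chart set \<Rightarrow> ('a, 'n) tensor_field11 \<Rightarrow> 'a \<Rightarrow> bool" where
  "algebraically_generic M \<A> K p \<longleftrightarrow>
     (\<exists>W S. openin M W \<and> p \<in> W \<and>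
        (\<forall>q\<in>W. \<forall>c\<in>charts_at \<A> q. has_segre_characteristic (complexify (K c q)) S))"

definition smooth_eigenvalue_on ::
  "('a, 'n::finite) chart set \<Rightarrow> ('a, 'n) tensor_field11 \<Rightarrow> 'a set \<Rightarrow> ('a \<Rightarrow> complex) \<Rightarrow> bool" where
  "smooth_eigenvalue_on \<A> K W l \<longleftrightarrow>
     smooth_fun_on \<A> W l \<and>
     (\<forall>q\<in>W. \<forall>c\<in>charts_at \<A> q. l q \<in> eigenvalues_of (complexify (K c q)))"

text \<open>
  Near an algebraically generic point the eigenvalues are smooth functions, and every eigenvalue
  at the point belongs to exactly one germ of such a function.
\<close>

definition weakly_nonlinear_at_generic_points ::
  "'a topology \<Rightarrow> ('a, 'n::finite) chart set \<Rightarrow> ('a, 'n) tensor_field11 \<Rightarrow> bool" where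
  "weakly_nonlinear_at_generic_points M \<A> K \<longleftrightarrow>
     (\<forall>p\<in>topspace M. algebraically_generic M \<A> K p \<longrightarrow>
        (\<forall>W l. openin M W \<and> p \<in> W \<and> smooth_eigenvalue_on \<A> K W l \<longrightarrow>
           (\<forall>c\<in>charts_at \<A> p. \<forall>v\<in>eigenspace_of (complexify (K c p)) (l p).
              complex_differential c l p v = 0)))"

end

theory Submission
  imports Defs "Jordan_Normal_Form.Jordan_Normal_Form_Uniqueness"
    "Jordan_Normal_Form.Jordan_Normal_Form_Existence"
begin

no_notation Matrix.vec_index (infixl "$" 100)

text \<open>
  Let \<open>\<alpha>(\<xi>) = d\<sigma>\<^sub>1(K\<^sup>n\<^sup>-\<^sup>1 \<xi>) + \<dots> + d\<sigma>\<^sub>n(\<xi>)\<close>.  Near a point where the number of distinct eigenvalues is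
  locally constant, every eigenvalue \<open>l\<close> is a smooth function of constant multiplicity \<open>m\<^sub>l\<close>.
  Differentiating \<open>\<chi>(t) = \<Prod>l. (t - l) ^ m\<^sub>l\<close> at fixed \<open>t\<close> and substituting \<open>K\<close> for \<open>t\<close> gives
  \<open>\<alpha>(\<xi>) = \<Sum>l. m\<^sub>l dl(Q\<^sub>l(K) \<xi>)\<close> with \<open>Q\<^sub>l = \<chi> / (t - l)\<close>.  By Cayley-Hamilton, \<open>Q\<^sub>l(K) \<xi>\<close> is an
  eigenvector for \<open>l\<close>, so \<open>\<alpha>\<close> vanishes if \<open>K\<close> is weakly nonlinear.  Conversely, \<open>Q\<^sub>l(K) \<noteq> 0\<close> because
  \<open>K\<close> is gl-regular, and inserting \<open>\<xi> = R(K) \<zeta>\<close>, with \<open>R\<close> the product of \<open>t - l'\<close> over the other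
  eigenvalues \<open>l'\<close>, isolates the summand of \<open>l\<close>.

  The points in question are exactly the algebraically generic ones, since the characteristic
  polynomial of a gl-regular \<open>K\<close> determines its Segre characteristic.  They are dense, since the number
  of distinct eigenvalues is bounded and lower semicontinuous; hence \<open>\<alpha> = 0\<close> everywhere by continuity.
\<close>

section \<open>Calculus of smooth maps\<close>

text \<open>The eigenvalues are in general multiple roots, so the implicit function theorem cannot
  be applied to \<open>\<chi>\<close> itself. A root of order exactly \<open>m\<close> is, however,
  a simple root of the derivative of order \<open>m - 1\<close> in \<open>t\<close>, and this makes
  it smooth once it is known to be continuous. The formula for the derivative of
  \<open>\<chi>\<close> is reached without differentiating a product: both sides are polynomials in
  \<open>t\<close> of degree less than \<open>n\<close>, and they are compared modulo each power
  \<open>(t - l) ^ m\<close>. Such a congruence is a list of vanishing \<open>t\<close>-derivatives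
  at \<open>l\<close>, each obtained by differentiating a relation that holds along the eigenvalue.
  Weak nonlinearity quantifies over all smooth eigenvalue functions near a point, whereas the proof
  constructs particular branches. The two are matched by a uniqueness radius: near the point only
  one eigenvalue lies close to a given one. The functions \<open>\<sigma>\<close> are real while
  eigenvalues and eigenvectors may be complex, so covectors are extended complex-linearly before
  they are tested on eigenvectors.\<close>

lemma Ck_on_cong:
  assumes "open S" "\<And>x. x \<in> S \<Longrightarrow> f x = g x" "Ck_on k S f"
  shows "Ck_on k S g"
  using assms(2,3)
proof (induction k arbitrary: f g)
  case 0
  then show ?case using continuous_on_cong by fastforce
next
  case (Suc k)
  have d: "f differentiable (at x)" if "x \<in> S" for x using Suc.prems that by auto
  have g: "(g has_derivative frechet_derivative f (at x)) (at x)" if "x \<in> S" for x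
    using has_derivative_transform_within_open[OF _ \<open>open S\<close> that, of f _ UNIV g] d[OF that] Suc.prems(1)
    by (simp add: frechet_derivative_works)
  have "Ck_on k S (\<lambda>x. frechet_derivative g (at x) v)" for v
  proof (rule Suc.IH)
    show "Ck_on k S (\<lambda>x. frechet_derivative f (at x) v)" using Suc.prems by simp
  qed (use g frechet_derivative_at in fastforce)
  with g show ?case by (auto simp: differentiable_def)
qed

text \<open>Allows the derivative to be given by an explicit formula \<open>f'\<close> on
  \<open>S\<close>; the values of \<open>frechet_derivative\<close> outside \<open>S\<close> do not
  matter because \<open>S\<close> is open.\<close>

lemma Ck_on_SucI:
  assumes "open S" "\<And>x. x \<in> S \<Longrightarrow> (f has_derivative f' x) (at x)"
    and "\<And>v. Ck_on k S (\<lambda>x. f' x v)"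
  shows "Ck_on (Suc k) S f"
proof -
  have "Ck_on k S (\<lambda>x. frechet_derivative f (at x) v)" for v
    by (rule Ck_on_cong[OF assms(1) _ assms(3)[of v]]) (use assms(2) frechet_derivative_at in fastforce)
  then show ?thesis using assms(2) by (auto simp: differentiable_def)
qed

lemma Ck_on_has_derivative:
  "Ck_on (Suc k) S f \<Longrightarrow> x \<in> S \<Longrightarrow> (f has_derivative frechet_derivative f (at x)) (at x)"
  by (simp add: frechet_derivative_works)

lemma Ck_on_SucD: "Ck_on (Suc k) S f \<Longrightarrow> Ck_on k S f"
proof (induction k arbitrary: f)
  case 0
  then show ?case
    by (auto intro!: continuous_at_imp_continuous_on differentiable_imp_continuous_within)
next
  case (Suc k)
  then show ?case by (metis Ck_on.simps(2))
qed

lemma Ck_on_const: "Ck_on k S (\<lambda>x. c)"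
proof (induction k arbitrary: c)
  case (Suc k)
  then show ?case by simp
qed simp

lemma Ck_on_bounded_linear:
  assumes "bounded_linear h" "open S" "Ck_on k S f"
  shows "Ck_on k S (\<lambda>x. h (f x))"
  using assms(3)
proof (induction k arbitrary: f)
  case 0
  then show ?case
    using assms(1) by (simp add: bounded_linear.continuous_on)
next
  case (Suc k)
  show ?case
    by (rule Ck_on_SucI[OF assms(2) bounded_linear.has_derivative[OF assms(1) Ck_on_has_derivative[OF Suc.prems]]])
      (use Suc in auto)
qed

lemma Ck_on_add:
  assumes "open S" "Ck_on k S f" "Ck_on k S g"
  shows "Ck_on k S (\<lambda>x. f x + g x)"
  using assms(2,3)
proof (induction k arbitrary: f g)
  case 0
  then show ?case by (simp add: continuous_on_add)
next
  case (Suc k)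
  show ?case
    by (rule Ck_on_SucI[OF assms(1) has_derivative_add[OF Ck_on_has_derivative[OF Suc.prems(1)] Ck_on_has_derivative[OF Suc.prems(2)]]])
      (use Suc in auto)
qed

lemma Ck_on_mult:
  fixes f g :: "'a::euclidean_space \<Rightarrow> 'b::real_normed_algebra"
  assumes "open S" "Ck_on k S f" "Ck_on k S g"
  shows "Ck_on k S (\<lambda>x. f x * g x)"
  using assms(2,3)
proof (induction k arbitrary: f g)
  case 0
  then show ?case by (simp add: continuous_on_mult)
next
  case (Suc k)
  show ?case
    by (rule Ck_on_SucI[OF assms(1) has_derivative_mult[OF Ck_on_has_derivative[OF Suc.prems(1)] Ck_on_has_derivative[OF Suc.prems(2)]]])
      (use Suc Ck_on_SucD[OF Suc.prems(1)] Ck_on_SucD[OF Suc.prems(2)] in \<open>auto intro!: Ck_on_add assms(1)\<close>)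
qed

text \<open>The derivative of \<open>inverse (f x)\<close> contains \<open>inverse (f x)\<close>
  again, but only one order of smoothness less is required of it, so the induction closes.\<close>

lemma Ck_on_inverse:
  fixes f :: "'a::euclidean_space \<Rightarrow> 'b::real_normed_field"
  assumes "open S" "Ck_on k S f" "\<And>x. x \<in> S \<Longrightarrow> f x \<noteq> 0"
  shows "Ck_on k S (\<lambda>x. inverse (f x))"
  using assms(2,3)
proof (induction k arbitrary: f)
  case 0
  then show ?case by (simp add: continuous_on_inverse)
next
  case (Suc k)
  have i: "Ck_on k S (\<lambda>x. inverse (f x))" using Suc Ck_on_SucD by blast
  have d: "((\<lambda>x. inverse (f x)) has_derivative
      (\<lambda>h. (- 1) * (inverse (f x) * frechet_derivative f (at x) h * inverse (f x)))) (at x)" if "x \<in> S" for x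
    using Deriv.has_derivative_inverse[OF Suc.prems(2)[OF that] Ck_on_has_derivative[OF Suc.prems(1) that]] by simp
  have "Ck_on k S (\<lambda>x. (- 1) * (inverse (f x) * frechet_derivative f (at x) v * inverse (f x)))" for v
    by (intro Ck_on_mult Ck_on_const assms(1) i) (use Suc.prems in simp)
  then show ?case by (intro Ck_on_SucI[OF assms(1) d])
qed

section \<open>Closure properties of smooth maps\<close>

lemma smooth_on_const: "smooth_on S (\<lambda>x. c)"
  by (simp add: smooth_on_def Ck_on_const)

lemma smooth_on_cong:
  "open S \<Longrightarrow> (\<And>x. x \<in> S \<Longrightarrow> f x = g x) \<Longrightarrow> smooth_on S f \<Longrightarrow> smooth_on S g"
  unfolding smooth_on_def using Ck_on_cong by blast

lemma smooth_on_bounded_linear: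
  "bounded_linear h \<Longrightarrow> open S \<Longrightarrow> smooth_on S f \<Longrightarrow> smooth_on S (\<lambda>x. h (f x))"
  by (simp add: smooth_on_def Ck_on_bounded_linear)

lemma smooth_on_mult:
  fixes f g :: "'a::euclidean_space \<Rightarrow> 'b::real_normed_algebra"
  shows "open S \<Longrightarrow> smooth_on S f \<Longrightarrow> smooth_on S g \<Longrightarrow> smooth_on S (\<lambda>x. f x * g x)"
  by (simp add: smooth_on_def Ck_on_mult)

lemma Ck_on_sum:
  assumes "open S" "\<And>i. i \<in> I \<Longrightarrow> Ck_on k S (f i)"
  shows "Ck_on k S (\<lambda>x. \<Sum>i\<in>I. f i x)"
  using assms(2)
  by (induction I rule: infinite_finite_induct) (auto intro!: Ck_on_const Ck_on_add assms(1))

lemma Ck_on_power: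
  fixes f :: "'a::euclidean_space \<Rightarrow> 'b::real_normed_field"
  assumes "open S" "Ck_on k S f"
  shows "Ck_on k S (\<lambda>x. f x ^ i)"
  by (induction i) (auto intro!: Ck_on_const Ck_on_mult assms)

lemma smooth_on_sum:
  "open S \<Longrightarrow> (\<And>i. i \<in> I \<Longrightarrow> smooth_on S (f i)) \<Longrightarrow> smooth_on S (\<lambda>x. \<Sum>i\<in>I. f i x)"
  by (simp add: smooth_on_def Ck_on_sum)

lemma smooth_on_imp_continuous_on: "smooth_on S f \<Longrightarrow> continuous_on S f"
  unfolding smooth_on_def by (metis Ck_on.simps(1))

lemma smooth_on_has_derivative:
  "smooth_on S f \<Longrightarrow> x \<in> S \<Longrightarrow> (f has_derivative frechet_derivative f (at x)) (at x)"
  unfolding smooth_on_def using Ck_on_has_derivative by blast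

lemma smooth_on_subset:
  assumes "smooth_on S f" "T \<subseteq> S"
  shows "smooth_on T f"
proof -
  have "Ck_on k S f \<Longrightarrow> Ck_on k T f" for k
    using assms(2) by (induction k arbitrary: f) (auto intro: continuous_on_subset)
  with assms(1) show ?thesis by (simp add: smooth_on_def)
qed

lemma smooth_on_frechet_derivative:
  assumes "smooth_on S f"
  shows "smooth_on S (\<lambda>x. frechet_derivative f (at x) v)"
  unfolding smooth_on_def
proof
  fix k show "Ck_on k S (\<lambda>x. frechet_derivative f (at x) v)"
    using assms Ck_on.simps(2)[of k S f] unfolding smooth_on_def by blast
qed

text \<open>As \<open>h\<close> vanishes at \<open>x\<close>, the product rule loses the term with
  the derivative of \<open>g\<close>, and continuity of \<open>g\<close> is enough. This admits a
  factor whose differentiability is still to be proved.\<close>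

lemma has_derivative_mult_zero:
  fixes h g :: "'a::real_normed_vector \<Rightarrow> 'b::real_normed_field"
  assumes h: "(h has_derivative h') (at x)" and "h x = 0" and g: "isCont g x"
  shows "((\<lambda>y. h y * g y) has_derivative (\<lambda>v. h' v * g x)) (at x)"
proof -
  have bl: "bounded_linear h'" using h by (rule has_derivative_bounded_linear)
  obtain B where B: "B > 0" "\<And>v. norm (h' v) \<le> norm v * B"
    using bounded_linear.pos_bounded[OF bl] by blast
  have alt: "\<And>e. e > 0 \<Longrightarrow> \<exists>d>0. \<forall>y. norm (y - x) < d \<longrightarrow> norm (h y - h' (y - x)) \<le> e * norm (y - x)"
    using h assms(2) unfolding has_derivative_at_alt by auto
  show ?thesis unfolding has_derivative_at_alt
  proof (intro conjI allI impI)
    show "bounded_linear (\<lambda>v. h' v * g x)"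
      using bounded_linear_compose[OF bounded_linear_mult_left bl] .
    fix e :: real assume "e > 0"
    \<comment> \<open>The error is
      \<open>(h y - h' (y - x)) * g y + h' (y - x) * (g y - g x)\<close>. The constants
      \<open>e1\<close> and \<open>e2\<close> keep each summand below half of
      \<open>e * norm (y - x)\<close>, and \<open>e2 \<le> 1\<close> bounds
      \<open>norm (g y)\<close> by \<open>norm (g x) + 1\<close>.\<close>
    define e1 where "e1 = e / (2 * (norm (g x) + 1))"
    have g1: "norm (g x) + 1 > 0" using norm_ge_zero[of "g x"] by linarith
    have e1: "e1 > 0" "e1 * (norm (g x) + 1) = e / 2"
      using \<open>e > 0\<close> g1 unfolding e1_def by (auto simp: field_simps)
    obtain d1 where d1: "d1 > 0" "\<And>y. norm (y - x) < d1 \<Longrightarrow> norm (h y - h' (y - x)) \<le> e1 * norm (y - x)"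
      using alt[OF e1(1)] by blast
    define e2 where "e2 = min 1 (e / (2 * B))"
    have e2: "e2 > 0" "e2 \<le> 1" "B * e2 \<le> e / 2"
      using \<open>e > 0\<close> B unfolding e2_def by (auto simp: min_def field_simps)
    obtain d2 where d2: "d2 > 0" "\<And>y. norm (y - x) < d2 \<Longrightarrow> norm (g y - g x) < e2"
      using g e2(1) unfolding continuous_at_eps_delta dist_norm by blast
    show "\<exists>d>0. \<forall>y. norm (y - x) < d \<longrightarrow>
        norm (h y * g y - h x * g x - h' (y - x) * g x) \<le> e * norm (y - x)"
    proof (intro exI[of _ "min d1 d2"] conjI allI impI)
      fix y assume y: "norm (y - x) < min d1 d2"
      have gy: "norm (g y) \<le> norm (g x) + 1"
        using d2(2)[of y] y e2(2) norm_triangle_sub[of "g y" "g x"] by linarith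
      have "norm (h y * g y - h x * g x - h' (y - x) * g x)
          = norm ((h y - h' (y - x)) * g y + h' (y - x) * (g y - g x))"
        by (simp add: assms(2) algebra_simps)
      also have "\<dots> \<le> norm (h y - h' (y - x)) * norm (g y) + norm (h' (y - x)) * norm (g y - g x)"
        by (metis norm_mult norm_triangle_ineq)
      also have "\<dots> \<le> (e1 * norm (y - x)) * (norm (g x) + 1) + (norm (y - x) * B) * e2"
        using d1(2)[of y] d2(2)[of y] y gy B e1 by (intro add_mono mult_mono) (auto intro: less_imp_le)
      also have "\<dots> = (e1 * (norm (g x) + 1)) * norm (y - x) + (B * e2) * norm (y - x)"
        by (simp add: algebra_simps)
      also have "\<dots> \<le> (e / 2) * norm (y - x) + (e / 2) * norm (y - x)"
        using e1 e2 by (intro add_mono mult_right_mono) auto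
      finally show "norm (h y * g y - h x * g x - h' (y - x) * g x) \<le> e * norm (y - x)" by simp
    qed (use d1 d2 in auto)
  qed
qed

text \<open>A summation range independent of \<open>p\<close> lets the values of a varying
  polynomial be compared term by term.\<close>

lemma poly_altdef_le:
  fixes p :: "'a::comm_semiring_1 poly"
  assumes "degree p \<le> n"
  shows "poly p z = (\<Sum>i\<le>n. Polynomial.coeff p i * z ^ i)"
  unfolding poly_altdef
  by (rule sum.mono_neutral_left) (use assms in \<open>auto simp: coeff_eq_0\<close>)

text \<open>
  Division of \<open>P x\<close> by \<open>t - f x\<close> turns the equation \<open>P y (f y) = 0\<close> into a formula for
  \<open>f y - f x\<close> in which \<open>f\<close> enters only through its continuity at \<open>x\<close>.
\<close>

lemma simple_root_has_derivative:
  fixes f :: "'a::real_normed_vector \<Rightarrow> complex"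
  assumes "open S" "x \<in> S" "\<And>y. y \<in> S \<Longrightarrow> degree (P y) \<le> n"
    and c: "\<And>i. ((\<lambda>y. Polynomial.coeff (P y) i) has_derivative c' i) (at x)"
    and f: "isCont f x" "\<And>y. y \<in> S \<Longrightarrow> poly (P y) (f y) = 0"
    and "poly (pderiv (P x)) (f x) \<noteq> 0"
  shows "(f has_derivative (\<lambda>v. - (\<Sum>i\<le>n. c' i v * f x ^ i) * inverse (poly (pderiv (P x)) (f x)))) (at x)"
proof -
  obtain q where q: "P x = [:- f x, 1:] * q"
    using f(2)[OF assms(2)] by (auto simp: poly_eq_0_iff_dvd)
  have qx: "poly (pderiv (P x)) (f x) = poly q (f x)"
    unfolding q by (simp add: pderiv_mult pderiv_pCons del: mult_pCons_left)
  define Q where "Q y = poly q (f y)" for y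
  have Q: "isCont Q x" unfolding Q_def using f(1) by (intro continuous_intros)
  have Qx: "Q x \<noteq> 0" using assms(7) qx by (simp add: Q_def)
  \<comment> \<open>\<open>N y\<close> is the value of \<open>P y - P x\<close> at
    \<open>f y\<close>, divided by \<open>Q y\<close>. Its coefficient differences vanish at
    \<open>x\<close>, which is the situation of \<open>has_derivative_mult_zero\<close>.\<close>
  define N where "N y = (\<Sum>i\<le>n. (Polynomial.coeff (P y) i - Polynomial.coeff (P x) i) * (f y ^ i * inverse (Q y)))" for y
  have N: "(N has_derivative (\<lambda>v. \<Sum>i\<le>n. c' i v * (f x ^ i * inverse (Q x)))) (at x)"
    unfolding N_def
  proof (intro has_derivative_sum has_derivative_mult_zero)
    fix i
    show "((\<lambda>y. Polynomial.coeff (P y) i - Polynomial.coeff (P x) i) has_derivative c' i) (at x)"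
      using has_derivative_diff[OF c has_derivative_const] by simp
    show "isCont (\<lambda>y. f y ^ i * inverse (Q y)) x" using f(1) Q Qx by (intro continuous_intros)
  qed simp
  have "eventually (\<lambda>y. y \<in> S) (nhds x)" using assms(1,2) by (simp add: eventually_nhds_in_open)
  moreover have "eventually (\<lambda>y. Q y \<noteq> 0) (nhds x)"
    using continuous_within_topological Q Qx tendsto_imp_eventually_ne[of Q "Q x" "at x" 0]
    by (metis (mono_tags, lifting) continuous_at eventually_nhds_conv_at)
  ultimately have ev: "eventually (\<lambda>y. f x - N y = f y) (nhds x)"
  proof eventually_elim
    case (elim y)
    have "0 = poly (P y) (f y) - poly (P x) (f y) + poly (P x) (f y)"
      using f(2) elim by simp
    also have "poly (P y) (f y) - poly (P x) (f y) = N y * Q y"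
      unfolding poly_altdef_le[OF assms(3)[OF elim(1)]] poly_altdef_le[OF assms(3)[OF assms(2)]] N_def
      unfolding sum_distrib_right sum_subtractf[symmetric]
      using elim(2) by (intro sum.cong) (auto simp: field_simps)
    also have "poly (P x) (f y) = (f y - f x) * Q y" by (simp add: q Q_def algebra_simps)
    finally have "Q y * (N y + (f y - f x)) = 0" by (simp add: algebra_simps)
    with elim(2) have "N y + (f y - f x) = 0" by simp
    then show ?case by (simp add: algebra_simps)
  qed
  have "((\<lambda>y. f x - N y) has_derivative (\<lambda>v. 0 - (\<Sum>i\<le>n. c' i v * (f x ^ i * inverse (Q x))))) (at x)"
    by (intro has_derivative_diff has_derivative_const N)
  then have "(f has_derivative (\<lambda>v. 0 - (\<Sum>i\<le>n. c' i v * (f x ^ i * inverse (Q x))))) (at x)"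
    using has_derivative_transform_eventually[of _ _ x UNIV f] ev eventually_nhds_x_imp_x[OF ev]
    by (simp add: eventually_nhds_conv_at)
  then show ?thesis by (simp add: Q_def qx sum_distrib_right sum_negf mult.assoc)
qed

text \<open>Bootstrapping: the derivative of \<open>f\<close> is a rational expression in
  \<open>f\<close> and in smooth coefficients, so \<open>f\<close> of class \<open>k\<close> has
  derivatives of class \<open>k\<close> and is of class \<open>k + 1\<close>. The start is
  continuity.\<close>

lemma simple_root_smooth_on:
  fixes f :: "'a::euclidean_space \<Rightarrow> complex"
  assumes "open S" "\<And>y. y \<in> S \<Longrightarrow> degree (P y) \<le> n"
    and c: "\<And>i. smooth_on S (\<lambda>y. Polynomial.coeff (P y) i)"
    and f: "continuous_on S f" "\<And>y. y \<in> S \<Longrightarrow> poly (P y) (f y) = 0"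
    and nz: "\<And>y. y \<in> S \<Longrightarrow> poly (pderiv (P y)) (f y) \<noteq> 0"
  shows "smooth_on S f"
  unfolding smooth_on_def
proof
  fix k show "Ck_on k S f"
  proof (induction k)
    case 0
    then show ?case using f by simp
  next
    case (Suc k)
    have pd: "poly (pderiv (P y)) (f y) = (\<Sum>i\<le>n. (of_nat (Suc i) * Polynomial.coeff (P y) (Suc i)) * f y ^ i)"
      if "y \<in> S" for y
      by (subst poly_altdef_le[of _ n])
        (use assms(2)[OF that] in \<open>auto simp: degree_pderiv coeff_pderiv simp del: of_nat_Suc\<close>)
    have c1: "Ck_on k S (\<lambda>y. Polynomial.coeff (P y) i)" for i using c by (simp add: smooth_on_def)
    have c2: "Ck_on k S (\<lambda>y. frechet_derivative (\<lambda>y. Polynomial.coeff (P y) i) (at y) v)" for i v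
      using smooth_on_frechet_derivative[OF c] by (simp add: smooth_on_def)
    have "Ck_on k S (\<lambda>y. \<Sum>i\<le>n. (of_nat (Suc i) * Polynomial.coeff (P y) (Suc i)) * f y ^ i)"
      by (intro Ck_on_sum Ck_on_mult Ck_on_power Ck_on_const assms(1) Suc c1)
    then have 1: "Ck_on k S (\<lambda>y. poly (pderiv (P y)) (f y))"
      by (rule Ck_on_cong[OF assms(1), rotated]) (simp add: pd)
    have 2: "Ck_on k S (\<lambda>y. (- 1) * (\<Sum>i\<le>n. frechet_derivative (\<lambda>y. Polynomial.coeff (P y) i) (at y) v * f y ^ i)
         * inverse (poly (pderiv (P y)) (f y)))" for v
      by (intro Ck_on_sum Ck_on_mult Ck_on_power Ck_on_inverse Ck_on_const assms(1) Suc c2 1 nz)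
    show ?case
    proof (rule Ck_on_SucI[OF assms(1)])
      fix x assume x: "x \<in> S"
      show "(f has_derivative (\<lambda>v. - (\<Sum>i\<le>n. frechet_derivative (\<lambda>y. Polynomial.coeff (P y) i) (at x) v * f x ^ i)
         * inverse (poly (pderiv (P x)) (f x)))) (at x)"
        by (rule simple_root_has_derivative[OF assms(1) x assms(2) smooth_on_has_derivative[OF c x] _ f(2) nz[OF x]])
          (use f(1) assms(1) x continuous_on_eq_continuous_at in auto)
    qed (use 2 in simp)
  qed
qed

section \<open>Roots of polynomials depending on a parameter\<close>

lemma sum_order_roots:
  fixes p :: "complex poly"
  assumes "p \<noteq> 0"
  shows "(\<Sum>z | poly p z = 0. Polynomial.order z p) = degree p"
proof -
  have "degree p = degree (Polynomial.smult (lead_coeff p) (\<Prod>z|poly p z = 0. [:-z, 1:] ^ Polynomial.order z p))"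
    by (simp add: complex_poly_decompose)
  also have "\<dots> = (\<Sum>z | poly p z = 0. degree ([:-z, 1:] ^ Polynomial.order z p))"
    using assms by (simp add: degree_prod_sum_eq)
  also have "\<dots> = (\<Sum>z | poly p z = 0. Polynomial.order z p)" by (simp add: degree_linear_power)
  finally show ?thesis ..
qed

text \<open>Expresses multiplicity by the vanishing of derivatives, a condition that can be
  followed, and differentiated, when the polynomial varies.\<close>

lemma higher_pderiv_order:
  fixes p :: "complex poly"
  assumes "p \<noteq> 0"
  shows "s < Polynomial.order a p \<Longrightarrow> poly ((pderiv ^^ s) p) a = 0"
    and "poly ((pderiv ^^ Polynomial.order a p) p) a \<noteq> 0"
proof -
  have *: "(\<forall>s<m. poly ((pderiv ^^ s) p) a = 0) \<and> poly ((pderiv ^^ m) p) a \<noteq> 0"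
    if "p \<noteq> 0" "Polynomial.order a p = m" for m p
    using that
  proof (induction m arbitrary: p)
    case 0
    then show ?case by (simp add: order_eq_0_iff)
  next
    case (Suc m)
    have "pderiv p \<noteq> 0"
    proof
      assume "pderiv p = 0"
      then obtain c where "p = [:c:]" using pderiv_eq_0_iff degree_eq_zeroE by blast
      with Suc.prems show False by (metis Zero_neq_Suc order_0I order_root pCons_0_0 poly_const_conv)
    qed
    moreover have "Polynomial.order a p = Suc (Polynomial.order a (pderiv p))"
      using order_pderiv[OF Suc.prems(1), of a] Suc.prems(2) order_root[of p a] by simp
    ultimately have IH: "(\<forall>s<m. poly ((pderiv ^^ s) (pderiv p)) a = 0)"
       "poly ((pderiv ^^ m) (pderiv p)) a \<noteq> 0"
      using Suc.IH[of "pderiv p"] Suc.prems by auto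
    have "poly p a = 0" using Suc.prems by (metis Zero_neq_Suc order_0I)
    have "poly ((pderiv ^^ s) p) a = 0" if "s < Suc m" for s
      using that IH(1) \<open>poly p a = 0\<close> by (cases s) (auto simp: funpow_Suc_right simp del: funpow.simps)
    then show ?case using IH(2) by (auto simp: funpow_Suc_right simp del: funpow.simps)
  qed
  from *[OF assms refl] show "s < Polynomial.order a p \<Longrightarrow> poly ((pderiv ^^ s) p) a = 0"
    and "poly ((pderiv ^^ Polynomial.order a p) p) a \<noteq> 0" by auto
qed

lemma linear_power_dvdI:
  fixes p :: "complex poly"
  assumes "\<And>s. s < m \<Longrightarrow> poly ((pderiv ^^ s) p) a = 0"
  shows "[:-a, 1:] ^ m dvd p"
proof (cases "p = 0")
  case False
  then have "m \<le> Polynomial.order a p" using assms higher_pderiv_order(2) not_le by blast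
  then show ?thesis by (simp add: order_divides)
qed simp

lemma tendsto_poly:
  fixes Q :: "'x \<Rightarrow> complex poly"
  assumes "\<And>i. ((\<lambda>x. Polynomial.coeff (Q x) i) \<longlongrightarrow> Polynomial.coeff p i) F"
    and "\<And>x. degree (Q x) \<le> n" "degree p \<le> n" "(g \<longlongrightarrow> z) F"
  shows "((\<lambda>x. poly (Q x) (g x)) \<longlongrightarrow> poly p z) F"
  unfolding poly_altdef_le[OF assms(2)] poly_altdef_le[OF assms(3)]
  by (intro tendsto_intros assms)

text \<open>The factor \<open>c\<close> is the same for all \<open>p\<close>, so limits, smoothness
  and derivatives of coefficients pass to higher \<open>t\<close>-derivatives.\<close>

lemma coeff_higher_pderiv:
  shows "\<exists>c. \<forall>p. Polynomial.coeff ((pderiv ^^ s) (p :: complex poly)) i = c * Polynomial.coeff p (s + i)"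
proof (induction s arbitrary: i)
  case 0
  then show ?case by (auto intro: exI[of _ 1])
next
  case (Suc s)
  from Suc.IH[of "Suc i"] obtain c where "\<forall>p. Polynomial.coeff ((pderiv ^^ s) (p :: complex poly)) (Suc i) = c * Polynomial.coeff p (s + Suc i)" by blast
  then have "\<forall>p. Polynomial.coeff ((pderiv ^^ Suc s) (p :: complex poly)) i
      = (of_nat (Suc i) * c) * Polynomial.coeff p (Suc s + i)"
    by (simp only: funpow.simps o_apply coeff_pderiv add_Suc add_Suc_right mult.assoc)
      simp
  then show ?case by (rule exI)
qed

lemma degree_higher_pderiv_le: "degree ((pderiv ^^ s) (p :: complex poly)) \<le> degree p"
  by (induction s) (auto simp: degree_pderiv)

text \<open>If every root of the monic \<open>Q x\<close> had distance at least
  \<open>\<epsilon>\<close> from \<open>a\<close>, the product of these distances with multiplicity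
  would give \<open>norm (poly (Q x) a) \<ge> \<epsilon> ^ n\<close>; but these values tend to
  \<open>poly p a = 0\<close>.\<close>

lemma eventually_root_near:
  fixes Q :: "'x \<Rightarrow> complex poly"
  assumes "\<And>i. ((\<lambda>x. Polynomial.coeff (Q x) i) \<longlongrightarrow> Polynomial.coeff p i) F"
    and "\<And>x. degree (Q x) = n" "\<And>x. lead_coeff (Q x) = 1" "degree p \<le> n"
    and "poly p a = 0" "\<epsilon> > 0"
  shows "eventually (\<lambda>x. \<exists>z. dist z a < \<epsilon> \<and> poly (Q x) z = 0) F"
proof -
  have "((\<lambda>x. poly (Q x) a) \<longlongrightarrow> poly p a) F"
    by (rule tendsto_poly[OF assms(1)]) (use assms in auto)
  then have "eventually (\<lambda>x. norm (poly (Q x) a) < \<epsilon> ^ n) F"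
    using tendstoD[of "\<lambda>x. poly (Q x) a" "poly p a" F "\<epsilon> ^ n"] assms(5,6) by (simp add: dist_norm)
  then show ?thesis
  proof eventually_elim
    case (elim x)
    show ?case
    proof (rule ccontr)
      assume "\<not> ?case"
      then have far: "\<epsilon> \<le> norm (a - z)" if "poly (Q x) z = 0" for z
        using that by (force simp: dist_norm norm_minus_commute)
      have Q0: "Q x \<noteq> 0" using assms(3)[of x] by auto
      have "\<epsilon> ^ n = (\<Prod>z | poly (Q x) z = 0. \<epsilon> ^ Polynomial.order z (Q x))"
        using sum_order_roots[OF Q0] assms(2) by (simp add: power_sum[symmetric])
      also have "\<dots> \<le> (\<Prod>z | poly (Q x) z = 0. norm (a - z) ^ Polynomial.order z (Q x))"
        using far assms(6) by (intro prod_mono) (auto intro: power_mono)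
      also have "\<dots> = norm (\<Prod>z | poly (Q x) z = 0. poly ([:-z, 1:] ^ Polynomial.order z (Q x)) a)"
        by (simp add: prod_norm[symmetric] norm_power)
      also have "\<dots> = norm (poly (Q x) a)"
        using arg_cong[OF complex_poly_decompose[of "Q x"], of "\<lambda>p. poly p a"] assms(3)[of x]
        by (simp add: poly_prod)
      finally show False using elim by simp
    qed
  qed
qed

text \<open>The factor 2 makes the open balls of radius \<open>s\<close> about distinct points of
  \<open>Z\<close> disjoint.\<close>

lemma finite_separated:
  fixes Z :: "'a::metric_space set"
  assumes "finite Z"
  obtains s where "s > 0" "\<And>a b. a \<in> Z \<Longrightarrow> b \<in> Z \<Longrightarrow> a \<noteq> b \<Longrightarrow> 2 * s \<le> dist a b"
proof -
  have "\<exists>s>0. \<forall>b\<in>Z. b \<noteq> a \<longrightarrow> s \<le> dist a b" for a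
    using finite_set_avoid[OF assms] by metis
  then have "\<exists>s. \<forall>a. s a > 0 \<and> (\<forall>b\<in>Z. b \<noteq> a \<longrightarrow> s a \<le> dist a b)"
    by (intro choice) blast
  then obtain s where s: "\<And>a. s a > 0" "\<And>a b. b \<in> Z \<Longrightarrow> b \<noteq> a \<Longrightarrow> s a \<le> dist a b" by blast
  \<comment> \<open>Inserting 1 keeps the minimum meaningful for empty \<open>Z\<close>.\<close>
  define t where "t = Min (insert 1 (s ` Z))"
  have t: "t > 0" "\<And>a. a \<in> Z \<Longrightarrow> t \<le> s a"
    using assms s(1) by (auto simp: t_def Min_gr_iff)
  show thesis
  proof (rule that[of "t / 2"])
    fix a b assume "a \<in> Z" "b \<in> Z" "a \<noteq> b"
    then show "2 * (t / 2) \<le> dist a b" using t(2)[of a] s(2)[of b a] by simp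
  qed (use t in simp)
qed

text \<open>Each root \<open>a\<close> of \<open>p\<close> attracts a root \<open>g a\<close> of
  \<open>Q x\<close>, distinct roots attract distinct ones, and the equality of the numbers of roots
  leaves no others. Multiplicities cannot rise on passing from \<open>a\<close> to
  \<open>g a\<close>, and they have the same sum \<open>n\<close>, so they are preserved.\<close>

lemma eventually_roots_bij:
  fixes Q :: "'x \<Rightarrow> complex poly"
  assumes co: "\<And>i. ((\<lambda>x. Polynomial.coeff (Q x) i) \<longlongrightarrow> Polynomial.coeff p i) F"
    and Q: "\<And>x. degree (Q x) = n" "\<And>x. lead_coeff (Q x) = 1"
    and p: "degree p = n" "lead_coeff p = 1"
    and card: "eventually (\<lambda>x. card {z. poly (Q x) z = 0} = card {z. poly p z = 0}) F"
    and "\<delta> > 0"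
  shows "eventually (\<lambda>x. \<exists>g. bij_betw g {z. poly p z = 0} {z. poly (Q x) z = 0} \<and>
      (\<forall>a. poly p a = 0 \<longrightarrow> dist (g a) a < \<delta> \<and> Polynomial.order (g a) (Q x) = Polynomial.order a p)) F"
proof -
  let ?Z = "{z. poly p z = 0}"
  have p0: "p \<noteq> 0" using p(2) by auto
  have Q0: "Q x \<noteq> 0" for x using Q(2)[of x] by auto
  have fin: "finite ?Z" using p0 by (rule poly_roots_finite)
  \<comment> \<open>The first derivative of \<open>p\<close> that is nonzero at \<open>a\<close>
    stays nonzero jointly for \<open>z\<close> near \<open>a\<close> and \<open>x\<close> far along
    \<open>F\<close>. This bounds the multiplicity of every root of \<open>Q x\<close> near
    \<open>a\<close>.\<close>
  have "\<exists>d>0. eventually (\<lambda>x. \<forall>z. dist z a < d \<longrightarrow> poly ((pderiv ^^ Polynomial.order a p) (Q x)) z \<noteq> 0) F" for a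
  proof -
    let ?m = "Polynomial.order a p"
    have "((\<lambda>y. poly ((pderiv ^^ ?m) (Q (fst y))) (snd y)) \<longlongrightarrow> poly ((pderiv ^^ ?m) p) a) (F \<times>\<^sub>F nhds a)"
    proof (rule tendsto_poly)
      fix i
      obtain c where "\<And>p. Polynomial.coeff ((pderiv ^^ ?m) p) i = c * Polynomial.coeff (p :: complex poly) (?m + i)"
        using coeff_higher_pderiv by blast
      then show "((\<lambda>x. Polynomial.coeff ((pderiv ^^ ?m) (Q (fst x))) i) \<longlongrightarrow> Polynomial.coeff ((pderiv ^^ ?m) p) i) (F \<times>\<^sub>F nhds a)"
        using filterlim_compose[OF co filterlim_fst] by (auto intro!: tendsto_intros)
      show "(snd \<longlongrightarrow> a) (F \<times>\<^sub>F nhds a)" by (rule filterlim_snd)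
      show "degree ((pderiv ^^ ?m) (Q (fst x))) \<le> n" for x
        using degree_higher_pderiv_le[of ?m "Q (fst x)"] Q(1) by simp
      show "degree ((pderiv ^^ ?m) p) \<le> n" using degree_higher_pderiv_le[of ?m p] p(1) by simp
    qed
    then have "eventually (\<lambda>y. poly ((pderiv ^^ ?m) (Q (fst y))) (snd y) \<noteq> 0) (F \<times>\<^sub>F nhds a)"
      using higher_pderiv_order(2)[OF p0] by (rule tendsto_imp_eventually_ne)
    then obtain A B where AB: "eventually A F" "eventually B (nhds a)"
        "\<And>x z. A x \<Longrightarrow> B z \<Longrightarrow> poly ((pderiv ^^ ?m) (Q x)) z \<noteq> 0"
      unfolding eventually_prod_filter by auto
    then obtain d where "d > 0" "\<And>z. dist z a < d \<Longrightarrow> B z" by (metis eventually_nhds_metric)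
    then show ?thesis using AB by (intro exI[of _ d]) (auto elim: eventually_mono)
  qed
  then have "\<exists>d. \<forall>a. d a > 0 \<and> eventually (\<lambda>x. \<forall>z. dist z a < d a \<longrightarrow> poly ((pderiv ^^ Polynomial.order a p) (Q x)) z \<noteq> 0) F"
    by (intro choice allI)
  then obtain d where d: "\<And>a. d a > 0" "\<And>a. eventually (\<lambda>x. \<forall>z. dist z a < d a \<longrightarrow> poly ((pderiv ^^ Polynomial.order a p) (Q x)) z \<noteq> 0) F"
    by blast
  obtain s where s: "s > 0" "\<And>a b. a \<in> ?Z \<Longrightarrow> b \<in> ?Z \<Longrightarrow> a \<noteq> b \<Longrightarrow> 2 * s \<le> dist a b"
    using finite_separated[OF fin] by blast
  define e where "e a = min \<delta> (min s (d a))" for a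
  have e: "e a > 0" for a using d(1) s(1) assms(7) by (simp add: e_def)
  have "eventually (\<lambda>x. \<forall>a\<in>?Z. \<exists>z. dist z a < e a \<and> poly (Q x) z = 0) F"
    by (intro eventually_ball_finite fin ballI eventually_root_near[OF co Q]) (use p e in auto)
  moreover have "eventually (\<lambda>x. \<forall>a\<in>?Z. \<forall>z. dist z a < d a \<longrightarrow> poly ((pderiv ^^ Polynomial.order a p) (Q x)) z \<noteq> 0) F"
    by (intro eventually_ball_finite fin ballI d)
  ultimately show ?thesis using card
  proof eventually_elim
    case (elim x)
    then obtain g where g: "\<And>a. a \<in> ?Z \<Longrightarrow> dist (g a) a < e a" "\<And>a. a \<in> ?Z \<Longrightarrow> poly (Q x) (g a) = 0"
      by metis
    have "inj_on g ?Z"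
    proof (rule inj_onI, rule ccontr)
      fix a b assume ab: "a \<in> ?Z" "b \<in> ?Z" "g a = g b" "a \<noteq> b"
      have "dist a b \<le> dist (g a) a + dist (g b) b"
        using ab(3) dist_triangle2[of a b "g a"] by (simp add: dist_commute)
      then show False using g(1)[OF ab(1)] g(1)[OF ab(2)] s(2)[OF ab(1,2,4)] by (simp add: e_def)
    qed
    moreover have "g ` ?Z \<subseteq> {z. poly (Q x) z = 0}" using g(2) by auto
    ultimately have bij: "bij_betw g ?Z {z. poly (Q x) z = 0}"
      using elim(3) poly_roots_finite[OF Q0[of x]]
      by (metis bij_betw_def card_image card_subset_eq)
    have le: "Polynomial.order (g a) (Q x) \<le> Polynomial.order a p" if "a \<in> ?Z" for a
    proof -
      have "poly ((pderiv ^^ Polynomial.order a p) (Q x)) (g a) \<noteq> 0"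
        using elim(2) that g(1)[OF that] by (auto simp: e_def)
      then show ?thesis using higher_pderiv_order(1)[OF Q0] not_le by blast
    qed
    have "(\<Sum>a\<in>?Z. Polynomial.order (g a) (Q x)) = (\<Sum>z | poly (Q x) z = 0. Polynomial.order z (Q x))"
      by (rule sum.reindex_bij_betw[OF bij])
    also have "\<dots> = (\<Sum>a\<in>?Z. Polynomial.order a p)"
      by (simp add: sum_order_roots[OF Q0] sum_order_roots[OF p0] Q p)
    finally have "Polynomial.order (g a) (Q x) = Polynomial.order a p" if "a \<in> ?Z" for a
      using sum_mono_inv[OF _ le that fin] by simp
    then show ?case using bij g by (intro exI[of _ g]) (auto simp: e_def)
  qed
qed

text \<open>Constant order \<open>m\<close> makes \<open>f x\<close> a simple root of the derivative
  of order \<open>m - 1\<close> at every point of \<open>S\<close>, and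
  \<open>coeff_higher_pderiv\<close> keeps the coefficients smooth.\<close>

lemma root_of_constant_order_smooth_on:
  fixes P :: "'a::euclidean_space \<Rightarrow> complex poly"
  assumes "open S" "\<And>i. smooth_on S (\<lambda>x. Polynomial.coeff (P x) i)"
    and "\<And>x. degree (P x) = n" "\<And>x. lead_coeff (P x) = 1"
    and "continuous_on S f" "\<And>x. x \<in> S \<Longrightarrow> Polynomial.order (f x) (P x) = m" "m > 0"
  shows "smooth_on S f"
proof (rule simple_root_smooth_on[where P = "\<lambda>x. (pderiv ^^ (m - 1)) (P x)"])
  have P0: "P x \<noteq> 0" for x using assms(4)[of x] by auto
  show "degree ((pderiv ^^ (m - 1)) (P y)) \<le> n" for y
    using degree_higher_pderiv_le[of "m - 1" "P y"] assms(3) by simp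
  show "smooth_on S (\<lambda>y. Polynomial.coeff ((pderiv ^^ (m - 1)) (P y)) i)" for i
  proof -
    obtain c where "\<And>p. Polynomial.coeff ((pderiv ^^ (m - 1)) p) i = c * Polynomial.coeff (p :: complex poly) (m - 1 + i)"
      using coeff_higher_pderiv by blast
    then show ?thesis by (auto intro!: smooth_on_mult smooth_on_const assms)
  qed
  show "poly ((pderiv ^^ (m - 1)) (P y)) (f y) = 0" if "y \<in> S" for y
    using higher_pderiv_order(1)[OF P0[of y], of "m - 1" "f y"] assms(6)[OF that] assms(7) by simp
  have "(pderiv ^^ m) p = pderiv ((pderiv ^^ (m - 1)) p)" for p :: "complex poly"
    using assms(7) by (cases m) auto
  then show "poly (pderiv ((pderiv ^^ (m - 1)) (P y))) (f y) \<noteq> 0" if "y \<in> S" for y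
    using higher_pderiv_order(2)[OF P0[of y], of "f y"] assms(6)[OF that] by simp
qed (use assms in auto)

text \<open>\<open>eventually_roots_bij\<close> gives a bijection for each \<open>y\<close>
  separately, with no relation between different \<open>y\<close>. The radius \<open>d\<close>, at
  most half of any distance between roots at \<open>x0\<close>, removes the ambiguity: exactly one
  root of \<open>P y\<close> lies within \<open>d\<close> of \<open>a\<close>. The last property
  later identifies arbitrary continuous eigenvalue functions with a branch.\<close>

lemma root_branches:
  fixes P :: "'a::euclidean_space \<Rightarrow> complex poly"
  assumes U: "open U" "x0 \<in> U" and P: "\<And>i. smooth_on U (\<lambda>x. Polynomial.coeff (P x) i)"
    and n: "\<And>x. degree (P x) = n" "\<And>x. lead_coeff (P x) = 1"
    and card: "eventually (\<lambda>x. card {z. poly (P x) z = 0} = card {z. poly (P x0) z = 0}) (nhds x0)"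
  obtains V L d where "open V" "x0 \<in> V" "V \<subseteq> U" "d > 0"
    "\<And>a. poly (P x0) a = 0 \<Longrightarrow> L a x0 = a"
    "\<And>a. poly (P x0) a = 0 \<Longrightarrow> smooth_on V (L a)"
    "\<And>y. y \<in> V \<Longrightarrow> bij_betw (\<lambda>a. L a y) {a. poly (P x0) a = 0} {a. poly (P y) a = 0}"
    "\<And>y a. y \<in> V \<Longrightarrow> poly (P x0) a = 0 \<Longrightarrow> Polynomial.order (L a y) (P y) = Polynomial.order a (P x0)"
    "\<And>y a z. y \<in> V \<Longrightarrow> poly (P x0) a = 0 \<Longrightarrow> poly (P y) z = 0 \<Longrightarrow> dist z a < d \<Longrightarrow> z = L a y"
proof -
  let ?Z = "\<lambda>x. {a. poly (P x) a = 0}"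
  have P0: "P x \<noteq> 0" for x using n(2)[of x] by auto
  have co: "((\<lambda>x. Polynomial.coeff (P x) i) \<longlongrightarrow> Polynomial.coeff (P y) i) (nhds y)" if "y \<in> U" for y i
  proof -
    have "isCont (\<lambda>x. Polynomial.coeff (P x) i) y"
      using smooth_on_imp_continuous_on[OF P, of i] U(1) that continuous_on_eq_continuous_at by blast
    then show ?thesis unfolding isCont_def using tendsto_at_iff_tendsto_nhds by fastforce
  qed
  obtain d where d: "d > 0" "\<And>a b. a \<in> ?Z x0 \<Longrightarrow> b \<in> ?Z x0 \<Longrightarrow> a \<noteq> b \<Longrightarrow> 2 * d \<le> dist a b"
    using finite_separated[OF poly_roots_finite[OF P0]] by blast
  define good where "good y \<longleftrightarrow> (\<exists>g. bij_betw g (?Z x0) (?Z y) \<and>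
      (\<forall>a. poly (P x0) a = 0 \<longrightarrow> dist (g a) a < d \<and> Polynomial.order (g a) (P y) = Polynomial.order a (P x0)))" for y
  have "eventually (\<lambda>y. good y \<and> y \<in> U \<and> card (?Z y) = card (?Z x0)) (nhds x0)"
    unfolding good_def
    by (intro eventually_conj eventually_roots_bij[OF co[OF U(2)] n n card d(1)] card
        eventually_nhds_in_open U)
  then obtain V where V: "open V" "x0 \<in> V" "\<And>y. y \<in> V \<Longrightarrow> good y" "\<And>y. y \<in> V \<Longrightarrow> y \<in> U"
      "\<And>y. y \<in> V \<Longrightarrow> card (?Z y) = card (?Z x0)"
    unfolding eventually_nhds by blast
  define L where "L a y = (THE z. poly (P y) z = 0 \<and> dist z a < d)" for a y
  have L: "bij_betw (\<lambda>a. L a y) (?Z x0) (?Z y) \<and>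
      (\<forall>a\<in>?Z x0. Polynomial.order (L a y) (P y) = Polynomial.order a (P x0) \<and> dist (L a y) a < d \<and>
        (\<forall>z\<in>?Z y. dist z a < d \<longrightarrow> z = L a y))" if y: "y \<in> V" for y
  proof -
    obtain g where g: "bij_betw g (?Z x0) (?Z y)"
      "\<And>a. a \<in> ?Z x0 \<Longrightarrow> dist (g a) a < d" "\<And>a. a \<in> ?Z x0 \<Longrightarrow> Polynomial.order (g a) (P y) = Polynomial.order a (P x0)"
      using V(3)[OF y] unfolding good_def by blast
    have uniq: "z = g a" if "a \<in> ?Z x0" "z \<in> ?Z y" "dist z a < d" for a z
    proof -
      obtain b where b: "b \<in> ?Z x0" "z = g b" using g(1) \<open>z \<in> ?Z y\<close> by (auto simp: bij_betw_def)
      have "dist a b < 2 * d"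
        using that(3) g(2)[OF b(1)] b(2) dist_triangle2[of a b z] by (simp add: dist_commute)
      then show ?thesis using d(2)[OF that(1) b(1)] b(2) by force
    qed
    have "L a y = g a" if "a \<in> ?Z x0" for a
      unfolding L_def
      by (rule the_equality) (use that uniq g(2) bij_betwE[OF g(1)] in blast)+
    then show ?thesis
      using g uniq bij_betw_cong[of "?Z x0" "\<lambda>a. L a y" g "?Z y"] by auto
  qed
  have L0: "L a x0 = a" if "poly (P x0) a = 0" for a
    using L[OF V(2)] that d(1) by fastforce
  have cont: "continuous_on V (L a)" if a: "poly (P x0) a = 0" for a
    unfolding continuous_on_eq_continuous_at[OF V(1)]
  proof
    fix y assume y: "y \<in> V"
    have da: "dist (L a y) a < d" and ra: "poly (P y) (L a y) = 0"
      using L[OF y] a bij_betwE[of "\<lambda>a. L a y" "?Z x0" "?Z y"] by auto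
    have "(L a \<longlongrightarrow> L a y) (nhds y)"
    proof (rule tendstoI)
      fix e :: real assume "e > 0"
      \<comment> \<open>A root within \<open>e'\<close> of \<open>L a y\<close> is still within
        \<open>d\<close> of \<open>a\<close>, so the root of \<open>P x\<close> found there must be
        \<open>L a x\<close>.\<close>
      define e' where "e' = min e (d - dist (L a y) a)"
      have "e' > 0" using \<open>e > 0\<close> da by (simp add: e'_def)
      then have "eventually (\<lambda>x. \<exists>z. dist z (L a y) < e' \<and> poly (P x) z = 0) (nhds y)"
        using n by (intro eventually_root_near[OF co n _ ra]) (use y V(4) in auto)
      moreover have "eventually (\<lambda>x. x \<in> V) (nhds y)" using V(1) y by (rule eventually_nhds_in_open)
      ultimately show "eventually (\<lambda>x. dist (L a x) (L a y) < e) (nhds y)"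
      proof eventually_elim
        case (elim x)
        then obtain z where z: "dist z (L a y) < e'" "poly (P x) z = 0" by blast
        have "dist z a < d" using z(1) dist_triangle[of z a "L a y"] by (simp add: e'_def)
        then have "z = L a x" using L[OF elim(2)] a z(2) by blast
        then show ?case using z(1) by (simp add: e'_def)
      qed
    qed
    then show "isCont (L a) y" by (simp add: isCont_def tendsto_at_iff_tendsto_nhds)
  qed
  have sm: "smooth_on V (L a)" if a: "poly (P x0) a = 0" for a
  proof (rule root_of_constant_order_smooth_on[OF V(1) _ n cont[OF a]])
    show "smooth_on V (\<lambda>x. Polynomial.coeff (P x) i)" for i
      using P by (rule smooth_on_subset) (use V(4) in auto)
    show "Polynomial.order (L a x) (P x) = Polynomial.order a (P x0)" if "x \<in> V" for x using L[OF that] a by blast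
    show "Polynomial.order a (P x0) > 0" using a P0 by (simp add: order_gt_0_iff)
  qed
  show thesis
    by (rule that[of V d L]) (use V d(1) L L0 sm in auto)
qed

section \<open>Characteristic polynomials and Jordan normal forms\<close>

text \<open>The matrix that \<open>has_jordan_form\<close> passes to \<open>jordan_nf\<close>; it
  carries matrices over an index type to matrices with numbered rows and columns.\<close>

definition jnf_mat :: "(nat \<Rightarrow> 'n) \<Rightarrow> 'a ^ 'n ^ 'n::finite \<Rightarrow> 'a Matrix.mat" where
  "jnf_mat e A = Matrix.mat CARD('n) CARD('n) (\<lambda>(i, j). A $ e i $ e j)"

lemma jnf_mat_carrier [simp]: "jnf_mat e (A :: 'a ^ 'n ^ 'n::finite) \<in> carrier_mat CARD('n) CARD('n)"
  by (simp add: jnf_mat_def)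

lemma index_jnf_mat [simp]:
  "i < CARD('n) \<Longrightarrow> j < CARD('n) \<Longrightarrow> jnf_mat e (A :: 'a ^ 'n ^ 'n::finite) $$ (i, j) = A $ e i $ e j"
  "dim_row (jnf_mat e A) = CARD('n)" "dim_col (jnf_mat e A) = CARD('n)"
  by (simp_all add: jnf_mat_def)

text \<open>Transport of permutations along \<open>e\<close> is a bijection that preserves signs, so
  the two Leibniz sums agree term by term.\<close>

lemma det_jnf_mat:
  fixes A :: "'a::comm_ring_1 ^ 'n ^ 'n::finite"
  assumes e: "bij_betw e {..<CARD('n)} (UNIV :: 'n set)"
  shows "Determinant.det (jnf_mat e A) = Determinants.det A"
proof -
  let ?I = "{0..<CARD('n)}"
  have e': "bij_betw e ?I UNIV" using e by (simp add: atLeast0LessThan)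
  have inj: "inj_on e ?I" and im: "e ` ?I = UNIV" using e' by (auto simp: bij_betw_def)
  have bij: "bij_betw (map_permutation ?I e) {p. p permutes ?I} {p. p permutes (UNIV :: 'n set)}"
    using bij_betw_permutations[OF e']
    by (simp add: map_permutation_def restrict_id_def im o_def cong: bij_betw_cong)
  have "Determinants.det A = (\<Sum>p | p permutes ?I. of_int (sign (map_permutation ?I e p)) *
      (\<Prod>i\<in>UNIV. A $ i $ map_permutation ?I e p i))"
    unfolding Determinants.det_def by (rule sum.reindex_bij_betw[OF bij, symmetric])
  also have "\<dots> = (\<Sum>p | p permutes ?I. of_int (sign p) * (\<Prod>i\<in>?I. A $ e i $ e (p i)))"
  proof (intro sum.cong refl arg_cong2[where f = "(*)"])
    fix p assume "p \<in> {p. p permutes ?I}"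
    then show "(of_int (sign (map_permutation ?I e p)) :: 'a) = of_int (sign p)"
      using sign_map_permutation[OF inj] by simp
    show "(\<Prod>i\<in>UNIV. A $ i $ map_permutation ?I e p i) = (\<Prod>i\<in>?I. A $ e i $ e (p i))"
      using inj by (subst prod.reindex_bij_betw[OF e', symmetric])
        (auto intro!: prod.cong simp: map_permutation_apply)
  qed
  also have "\<dots> = Determinant.det (jnf_mat e A)"
    unfolding det_def'[OF jnf_mat_carrier]
  proof (intro sum.cong prod.cong refl arg_cong2[where f = "(*)"])
    fix p i assume "p \<in> {p. p permutes ?I}" "i \<in> ?I"
    then have "p i < CARD('n)" using permutes_in_image[of p ?I i] by simp
    then show "A $ e i $ e (p i) = jnf_mat e A $$ (i, p i)" using \<open>i \<in> ?I\<close> by simp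
  qed
  finally show ?thesis by simp
qed

lemma poly_char_poly_jnf_mat:
  fixes A :: "'a::field ^ 'n ^ 'n::finite"
  assumes e: "bij_betw e {..<CARD('n)} (UNIV :: 'n set)"
  shows "poly (char_poly (jnf_mat e A)) t = Determinants.det (Finite_Cartesian_Product.mat t - A)"
proof -
  have "poly (char_poly (jnf_mat e A)) t = Determinant.det (- char_matrix (jnf_mat e A) t)"
    by (rule char_poly_matrix[OF jnf_mat_carrier])
  also have "- char_matrix (jnf_mat e A) t = jnf_mat e (Finite_Cartesian_Product.mat t - A)"
  proof (intro eq_matI)
    fix i j assume "i < dim_row (jnf_mat e (Finite_Cartesian_Product.mat t - A))"
      "j < dim_col (jnf_mat e (Finite_Cartesian_Product.mat t - A))"
    then show "(- char_matrix (jnf_mat e A) t) $$ (i, j) = jnf_mat e (Finite_Cartesian_Product.mat t - A) $$ (i, j)"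
      using e by (auto simp: char_matrix_def Finite_Cartesian_Product.mat_def bij_betw_def inj_on_def)
  qed (auto simp: char_matrix_def)
  finally show ?thesis by (simp add: det_jnf_mat[OF e])
qed

text \<open>Real data yield a polynomial over the complex numbers, because non-real eigenvalues must
  be among its roots.\<close>

definition char_poly_of :: "nat \<Rightarrow> (nat \<Rightarrow> real) \<Rightarrow> complex poly" where
  "char_poly_of n s = monom 1 n - (\<Sum>i=1..n. monom (of_real (s i)) (n - i))"

lemma coeff_char_poly_of:
  "Polynomial.coeff (char_poly_of n s) k = (if k = n then 1 else if k < n then - of_real (s (n - k)) else 0)"
proof -
  have "(\<Sum>i=1..n. Polynomial.coeff (monom (complex_of_real (s i)) (n - i)) k) =
      (\<Sum>i=1..n. if i = n - k \<and> k < n then of_real (s (n - k)) else 0)"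
    by (intro sum.cong) auto
  then show ?thesis
    by (auto simp: char_poly_of_def coeff_sum sum.delta)
qed

lemma degree_char_poly_of [simp]: "degree (char_poly_of n s) = n"
  by (intro antisym degree_le le_degree) (auto simp: coeff_char_poly_of)

lemma lead_coeff_char_poly_of [simp]: "lead_coeff (char_poly_of n s) = 1"
  by (simp add: coeff_char_poly_of)

lemma poly_char_poly_of:
  "poly (char_poly_of n s) t = t ^ n - (\<Sum>i=1..n. of_real (s i) * t ^ (n - i))"
  by (simp add: char_poly_of_def poly_monom poly_sum)

lemma det_complexify: "Determinants.det (complexify A) = of_real (Determinants.det A)"
  unfolding Determinants.det_def by (simp add: map_matrix_def)

text \<open>The hypothesis \<open>s\<close> speaks of real \<open>t\<close> only; two complex
  polynomials that agree on the infinite real line are equal.\<close>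

lemma char_poly_jnf_mat:
  fixes A :: "real ^ 'n ^ 'n::finite"
  assumes e: "bij_betw e {..<CARD('n)} (UNIV :: 'n set)"
    and s: "\<And>t. char_poly_at A t = t ^ CARD('n) - (\<Sum>i=1..CARD('n). s i * t ^ (CARD('n) - i))"
  shows "char_poly (jnf_mat e (complexify A)) = char_poly_of CARD('n) s"
proof -
  have "poly (char_poly (jnf_mat e (complexify A))) (of_real t) = poly (char_poly_of CARD('n) s) (of_real t)" for t
  proof -
    have "Finite_Cartesian_Product.mat (of_real t) - complexify A =
        complexify (t *\<^sub>R Finite_Cartesian_Product.mat 1 - A)"
      unfolding Finite_Cartesian_Product.vec_eq_iff by (auto simp: map_matrix_def Finite_Cartesian_Product.mat_def)
    then show ?thesis
      unfolding poly_char_poly_jnf_mat[OF e] poly_char_poly_of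
      using s[of t] by (simp add: det_complexify char_poly_at_def)
  qed
  then have "range complex_of_real \<subseteq> {z. poly (char_poly (jnf_mat e (complexify A)) - char_poly_of CARD('n) s) z = 0}"
    by auto
  moreover have "infinite (range complex_of_real)"
    by (simp add: finite_image_iff inj_on_def infinite_UNIV_char_0)
  ultimately have "char_poly (jnf_mat e (complexify A)) - char_poly_of CARD('n) s = 0"
    using poly_roots_finite finite_subset by blast
  then show ?thesis by simp
qed

lemma eigenvalues_of_iff_poly:
  fixes A :: "complex ^ 'n ^ 'n::finite"
  assumes e: "bij_betw e {..<CARD('n)} (UNIV :: 'n set)"
  shows "l \<in> eigenvalues_of A \<longleftrightarrow> poly (char_poly (jnf_mat e A)) l = 0"
proof -
  have "Finite_Cartesian_Product.mat l *v v = l *s v" for v :: "complex ^ 'n"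
    unfolding Finite_Cartesian_Product.vec_eq_iff
    by (auto simp: matrix_vector_mult_def Finite_Cartesian_Product.mat_def if_distrib[of "\<lambda>x. x * _"] sum.delta cong: if_cong)
  then have "(Finite_Cartesian_Product.mat l - A) *v v = 0 \<longleftrightarrow> A *v v = l *s v" for v
    by (auto simp: matrix_vector_mult_diff_rdistrib)
  then have "l \<in> eigenvalues_of A \<longleftrightarrow> \<not> invertible (Finite_Cartesian_Product.mat l - A)"
    unfolding invertible_left_inverse matrix_left_invertible_ker
    by (auto simp: eigenvalues_of_def eigenspace_of_def)
  then show ?thesis
    unfolding poly_char_poly_jnf_mat[OF e] by (simp add: invertible_det_nz)
qed

section \<open>Polynomials in a matrix\<close>

definition matrix_poly_apply :: "complex ^ 'n ^ 'n \<Rightarrow> complex poly \<Rightarrow> complex ^ 'n \<Rightarrow> complex ^ 'n::finite" where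
  "matrix_poly_apply A p v = (\<Sum>i\<le>degree p. Polynomial.coeff p i *s ((*v) A ^^ i) v)"

lemma matrix_poly_apply_le:
  "degree p \<le> n \<Longrightarrow> matrix_poly_apply A p v = (\<Sum>i\<le>n. Polynomial.coeff p i *s ((*v) A ^^ i) v)"
  unfolding matrix_poly_apply_def
  by (rule sum.mono_neutral_left) (auto simp: coeff_eq_0)

lemma matrix_poly_apply_0 [simp]: "matrix_poly_apply A 0 v = 0"
  by (simp add: matrix_poly_apply_def)

lemma matrix_poly_apply_1 [simp]: "matrix_poly_apply A 1 v = v"
  by (simp add: matrix_poly_apply_def)

lemma matrix_poly_apply_pCons [simp]:
  "matrix_poly_apply A (pCons a p) v = a *s v + A *v matrix_poly_apply A p v"
proof -
  have "matrix_poly_apply A (pCons a p) v = (\<Sum>i\<le>Suc (degree p). Polynomial.coeff (pCons a p) i *s ((*v) A ^^ i) v)"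
    by (rule matrix_poly_apply_le) (rule degree_pCons_le)
  also have "\<dots> = a *s v + (\<Sum>i\<le>degree p. Polynomial.coeff p i *s (A *v ((*v) A ^^ i) v))"
    by (subst sum.atMost_Suc_shift) simp
  finally show ?thesis
    by (simp add: matrix_poly_apply_def vec.linear_sum[OF matrix_vector_mul_linear_gen] vector_scalar_commute)
qed

lemma matrix_poly_apply_add: "matrix_poly_apply A (p + q) v = matrix_poly_apply A p v + matrix_poly_apply A q v"
  by (subst (1 2 3) matrix_poly_apply_le[of _ "max (degree p) (degree q)"])
    (auto simp: degree_add_le_max vector_sadd_rdistrib sum.distrib)

lemma matrix_poly_apply_smult: "matrix_poly_apply A (Polynomial.smult c p) v = c *s matrix_poly_apply A p v"
  by (subst (1 2) matrix_poly_apply_le[of _ "degree p"])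
    (auto simp: degree_smult_le vec.scale_sum_right vector_smult_assoc)

lemma matrix_poly_apply_sum: "matrix_poly_apply A (\<Sum>i\<in>I. f i) v = (\<Sum>i\<in>I. matrix_poly_apply A (f i) v)"
  by (induction I rule: infinite_finite_induct) (auto simp: matrix_poly_apply_add)

lemma linear_matrix_poly_apply:
  "matrix_poly_apply A p (v + w) = matrix_poly_apply A p v + matrix_poly_apply A p w"
  "matrix_poly_apply A p (c *s v) = c *s matrix_poly_apply A p v"
  by (induction p) (auto simp: matrix_vector_right_distrib vector_add_ldistrib vector_smult_assoc vector_scalar_commute mult.commute)

lemma matrix_poly_apply_zero [simp]: "matrix_poly_apply A p 0 = 0"
  using linear_matrix_poly_apply(2)[of A p 0 0] by simp

lemma matrix_poly_apply_vsum: "matrix_poly_apply A p (\<Sum>i\<in>I. f i) = (\<Sum>i\<in>I. matrix_poly_apply A p (f i))"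
  by (induction I rule: infinite_finite_induct) (auto simp: linear_matrix_poly_apply)

lemma matrix_poly_apply_mult: "matrix_poly_apply A (p * q) v = matrix_poly_apply A p (matrix_poly_apply A q v)"
  by (induction p) (auto simp: matrix_poly_apply_add matrix_poly_apply_smult)

lemma matrix_poly_apply_eigenvector:
  assumes "A *v v = l *s v"
  shows "matrix_poly_apply A p v = poly p l *s v"
  by (induction p) (auto simp: vector_scalar_commute assms vector_smult_assoc vector_sadd_rdistrib mult.commute)

text \<open>
  Let polynomials act on vectors by \<open>matrix_poly_apply A\<close>.  In this module over \<open>complex poly\<close>
  the matrix \<open>t - A\<close> satisfies \<open>\<Sum>j. (t - A)\<^sub>j\<^sub>i \<cdot> e\<^sub>j = 0\<close> for the standard basis \<open>e\<close>, and multiplying by the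
  adjugate of \<open>t - A\<close> turns this into \<open>\<chi> \<cdot> e\<^sub>k = 0\<close>.
\<close>

lemma Cayley_Hamilton:
  fixes A :: "complex ^ 'n ^ 'n::finite"
  assumes e: "bij_betw e {..<CARD('n)} (UNIV :: 'n set)"
  shows "matrix_poly_apply A (char_poly (jnf_mat e A)) v = 0"
proof -
  let ?n = "CARD('n)" and ?chi = "char_poly (jnf_mat e A)"
  let ?C = "char_poly_matrix (jnf_mat e A)"
  have C: "?C \<in> carrier_mat ?n ?n" by simp
  define N where "N = adj_mat ?C"
  have N: "N \<in> carrier_mat ?n ?n" "?C * N = ?chi \<cdot>\<^sub>m 1\<^sub>m ?n"
    using adj_mat[OF C] by (auto simp: N_def char_poly_def)
  define b where "b i = (axis (e i) 1 :: complex ^ 'n)" for i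
  have ind: "e i = e j \<longleftrightarrow> i = j" if "i < ?n" "j < ?n" for i j
    using e that by (auto simp: bij_betw_def inj_on_def)
  have Cij: "?C $$ (j, i) = (if i = j then [:0, 1:] else 0) - [:A $ e j $ e i:]" if "i < ?n" "j < ?n" for i j
    using that by (auto simp: char_poly_matrix_def)
  have Ab: "A *v b i = (\<Sum>j<?n. A $ e j $ e i *s b j)" if "i < ?n" for i
  proof -
    have "(\<Sum>j<?n. A $ e j $ e i *s b j) = (\<Sum>k\<in>UNIV. A $ k $ e i *s axis k 1)"
      unfolding b_def by (rule sum.reindex_bij_betw[OF e])
    also have "\<dots> = A *v b i"
      unfolding Finite_Cartesian_Product.vec_eq_iff b_def
      by (auto simp: sum_component matrix_vector_mult_def axis_def if_distrib[of "(*) _"] sum.delta cong: if_cong)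
    finally show ?thesis ..
  qed
  have row: "(\<Sum>j<?n. matrix_poly_apply A (?C $$ (j, i)) (b j)) = 0" if i: "i < ?n" for i
  proof -
    have "matrix_poly_apply A (?C $$ (j, i)) (b j) =
        (if j = i then A *v b i else 0) - A $ e j $ e i *s b j" if "j < ?n" for j
      unfolding Cij[OF i that] diff_conv_add_uminus matrix_poly_apply_add by auto
    then have "(\<Sum>j<?n. matrix_poly_apply A (?C $$ (j, i)) (b j)) =
        (\<Sum>j<?n. (if j = i then A *v b i else 0) - A $ e j $ e i *s b j)"
      by (intro sum.cong) auto
    also have "\<dots> = 0" using i Ab[OF i] by (simp add: sum_subtractf sum.delta)
    finally show ?thesis .
  qed
  have basis: "matrix_poly_apply A ?chi (b k) = 0" if k: "k < ?n" for k
  proof -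
    \<comment> \<open>\<open>?chi\<close> is spread over the \<open>k\<close>-th column of a scalar
      matrix, whose other entries are zero, in order to replace that matrix by
      \<open>?C * N\<close>.\<close>
    have "matrix_poly_apply A ?chi (b k) = (\<Sum>j<?n. matrix_poly_apply A ((?chi \<cdot>\<^sub>m 1\<^sub>m ?n) $$ (j, k)) (b j))"
      using k by (subst sum.remove[of _ k]) (auto intro!: sum.neutral)
    also have "\<dots> = (\<Sum>j<?n. \<Sum>i<?n. matrix_poly_apply A (N $$ (i, k) * ?C $$ (j, i)) (b j))"
      unfolding N(2)[symmetric] using k N(1) carrier_matD[OF C]
      by (intro sum.cong)
        (auto simp: times_mat_def scalar_prod_def matrix_poly_apply_sum[symmetric] atLeast0LessThan mult.commute)
    also have "\<dots> = (\<Sum>i<?n. matrix_poly_apply A (N $$ (i, k)) (\<Sum>j<?n. matrix_poly_apply A (?C $$ (j, i)) (b j)))"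
      by (subst sum.swap) (simp add: matrix_poly_apply_mult matrix_poly_apply_vsum)
    also have "\<dots> = 0" using row by simp
    finally show ?thesis .
  qed
  have "v = (\<Sum>k\<in>UNIV. v $ k *s axis k 1)" by (simp add: basis_expansion)
  also have "\<dots> = (\<Sum>k<?n. v $ e k *s b k)"
    unfolding b_def by (rule sum.reindex_bij_betw[OF e, symmetric])
  finally have "matrix_poly_apply A ?chi v = (\<Sum>k<?n. v $ e k *s matrix_poly_apply A ?chi (b k))"
    using matrix_poly_apply_vsum[of A ?chi "\<lambda>k. v $ e k *s b k" "{..<?n}"] by (simp add: linear_matrix_poly_apply)
  then show ?thesis using basis by simp
qed

section \<open>Matrices with one-dimensional eigenspaces\<close>

text \<open>Such matrices are known as nonderogatory. The generator may be 0, so the condition can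
  be stated for every \<open>l\<close> at once, eigenvalue or not.\<close>

definition cyclic_eigenspaces :: "complex ^ 'n ^ 'n::finite \<Rightarrow> bool" where
  "cyclic_eigenspaces A \<longleftrightarrow> (\<forall>l. \<exists>v\<in>eigenspace_of A l. \<forall>w\<in>eigenspace_of A l. \<exists>c. w = c *s v)"

lemma cyclic_eigenspacesI:
  assumes "\<And>l. l \<in> eigenvalues_of A \<Longrightarrow> vec.dim (eigenspace_of A l) = 1"
  shows "cyclic_eigenspaces A"
  unfolding cyclic_eigenspaces_def
proof
  fix l
  show "\<exists>v\<in>eigenspace_of A l. \<forall>w\<in>eigenspace_of A l. \<exists>c. w = c *s v"
  proof (cases "l \<in> eigenvalues_of A")
    case True
    obtain B where B: "B \<subseteq> eigenspace_of A l" "eigenspace_of A l \<subseteq> vec.span B" "card B = 1"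
      using vec.basis_exists[of "eigenspace_of A l"] assms[OF True] by metis
    then obtain v where "B = {v}" by (auto simp: card_1_singleton_iff)
    with B show ?thesis by (intro bexI[of _ v]) (auto simp: vec.span_singleton)
  next
    case False
    then have "\<forall>w\<in>eigenspace_of A l. w = 0" by (auto simp: eigenvalues_of_def)
    moreover have "0 \<in> eigenspace_of A l" by (simp add: eigenspace_of_def)
    ultimately show ?thesis by (intro bexI[of _ 0]) auto
  qed
qed

lemma linear_poly_apply: "matrix_poly_apply A [:-l, 1:] v = A *v v - l *s v"
  by (simp add: Finite_Cartesian_Product.vec_eq_iff)

lemma matrix_poly_apply_commute:
  "matrix_poly_apply A p (matrix_poly_apply A q v) = matrix_poly_apply A q (matrix_poly_apply A p v)"
  by (simp only: matrix_poly_apply_mult[symmetric] mult.commute)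

text \<open>A linear factor adds at most one dimension to the kernel: \<open>?R\<close> maps the new
  kernel into the eigenspace of \<open>l\<close>, at most a line, so the new kernel is spanned by
  the old one and one preimage of a generator.\<close>

lemma linear_factors_kernel:
  assumes "cyclic_eigenspaces A"
  shows "\<exists>B. finite B \<and> card B \<le> length ls \<and>
    {v. matrix_poly_apply A (\<Prod>l\<leftarrow>ls. [:-l, 1:]) v = 0} \<subseteq> vec.span B"
proof (induction ls)
  case Nil
  show ?case by (intro exI[of _ "{}"]) auto
next
  case (Cons l ls)
  let ?R = "matrix_poly_apply A (\<Prod>l\<leftarrow>ls. [:-l, 1:])"
  obtain B where B: "finite B" "card B \<le> length ls" "{v. ?R v = 0} \<subseteq> vec.span B" using Cons by blast
  obtain v0 where v0: "\<And>w. A *v w = l *s w \<Longrightarrow> \<exists>c. w = c *s v0"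
    using assms unfolding cyclic_eigenspaces_def eigenspace_of_def by blast
  \<comment> \<open>If \<open>v0\<close> has no preimage under \<open>?R\<close>, then
    \<open>u\<close> is arbitrary and only the case \<open>c = 0\<close> below can occur.\<close>
  obtain u where u: "(\<exists>u. ?R u = v0) \<Longrightarrow> ?R u = v0" by blast
  show ?case
  proof (intro exI[of _ "insert u B"] conjI subsetI)
    show "card (insert u B) \<le> length (l # ls)" using B by (simp add: card_insert_if)
    fix v assume "v \<in> {v. matrix_poly_apply A (\<Prod>l\<leftarrow>l # ls. [:-l, 1:]) v = 0}"
    then have "matrix_poly_apply A [:-l, 1:] (?R v) = 0"
      by (simp only: mem_Collect_eq list.map prod_list.Cons matrix_poly_apply_mult)
    then obtain c where c: "?R v = c *s v0" using v0 unfolding linear_poly_apply by force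
    show "v \<in> vec.span (insert u B)"
    proof (cases "c = 0")
      case True
      then have "v \<in> vec.span B" using c B(3) by auto
      then show ?thesis by (rule subsetD[OF vec.span_mono, rotated]) auto
    next
      case False
      have "?R (inverse c *s v) = v0"
        using c False by (simp add: linear_matrix_poly_apply vector_smult_assoc)
      then have "?R u = v0" using u by blast
      have "?R (v + (- c) *s u) = 0"
        unfolding linear_matrix_poly_apply \<open>?R u = v0\<close> c by (simp add: Finite_Cartesian_Product.vec_eq_iff)
      then have "v + (- c) *s u \<in> vec.span B" using B(3) by auto
      then have "v + (- c) *s u \<in> vec.span (insert u B)"
        by (rule subsetD[OF vec.span_mono, rotated]) auto
      moreover have "c *s u \<in> vec.span (insert u B)"
        by (intro vec.span_scale vec.span_base) simp
      ultimately have "(v + (- c) *s u) + c *s u \<in> vec.span (insert u B)" by (rule vec.span_add)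
      moreover have "(v + (- c) *s u) + c *s u = v" by (simp add: Finite_Cartesian_Product.vec_eq_iff)
      ultimately show ?thesis by simp
    qed
  qed (use B in simp)
qed

text \<open>In other words, the minimal polynomial has full degree. A nonzero \<open>p\<close>
  splits into \<open>degree p\<close> linear factors up to a constant, so the kernel of its action
  has dimension at most \<open>degree p\<close> and is not the whole space.\<close>

lemma ex_matrix_poly_apply_nonzero:
  fixes A :: "complex ^ 'n ^ 'n::finite"
  assumes "cyclic_eigenspaces A" "p \<noteq> 0" "degree p < CARD('n)"
  shows "\<exists>v. matrix_poly_apply A p v \<noteq> 0"
proof (rule ccontr)
  assume "\<not> ?thesis"
  then have z: "matrix_poly_apply A p v = 0" for v by blast
  obtain ls where ls: "Polynomial.smult (lead_coeff p) (\<Prod>l\<leftarrow>ls. [:-l, 1:]) = p" "length ls = degree p"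
    using fundamental_theorem_algebra_factorized by blast
  have "lead_coeff p *s matrix_poly_apply A (\<Prod>l\<leftarrow>ls. [:-l, 1:]) v = 0" for v
    using z[of v] by (subst (asm) ls(1)[symmetric]) (simp only: matrix_poly_apply_smult)
  then have "{v. matrix_poly_apply A (\<Prod>l\<leftarrow>ls. [:-l, 1:]) v = 0} = UNIV"
    using assms(2) by (auto simp: vec.scale_eq_0_iff)
  then obtain B where "finite B" "card B \<le> degree p" "(UNIV :: (complex ^ 'n) set) \<subseteq> vec.span B"
    using linear_factors_kernel[OF assms(1), of ls] ls(2) by metis
  then have "vec.dim (UNIV :: (complex ^ 'n) set) \<le> degree p"
    using vec.dim_le_card order_trans by metis
  then show False using assms(3) by (simp only: vec_dim_card)
qed

text \<open>The number of blocks for \<open>l\<close> is the dimension of the kernel of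
  \<open>A - l\<close>. Most of the work transports the eigenspace to the kernel of a matrix with
  numbered rows.\<close>

lemma one_jordan_block:
  fixes A :: "complex ^ 'n ^ 'n::finite"
  assumes cyc: "cyclic_eigenspaces A" and e: "bij_betw e {..<CARD('n)} (UNIV :: 'n set)"
    and bs: "jordan_nf (jnf_mat e A) bs"
  shows "length (filter (\<lambda>b. snd b = l) bs) \<le> 1"
proof -
  let ?n = "CARD('n)" and ?B = "jnf_mat e A"
  define C where "C = char_matrix ?B l"
  have C: "C \<in> carrier_mat ?n ?n" by (simp add: C_def)
  have C_ij: "C $$ (i, j) = A $ e i $ e j - (if i = j then l else 0)" if "i < ?n" "j < ?n" for i j
    using that by (simp add: C_def char_matrix_def)
  interpret K: kernel ?n ?n C by unfold_locales (rule C)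
  obtain v0 where v0: "A *v v0 = l *s v0" "\<And>w. A *v w = l *s w \<Longrightarrow> \<exists>c. w = c *s v0"
    using cyc unfolding cyclic_eigenspaces_def eigenspace_of_def by blast
  define x where "x = Matrix.vec ?n (\<lambda>i. v0 $ e i)"
  have mulC: "vec_index (C *\<^sub>v w) i = (A *v v) $ e i - l * v $ e i"
    if w: "w = Matrix.vec ?n (\<lambda>i. v $ e i)" and i: "i < ?n" for w v i
  proof -
    have "vec_index (C *\<^sub>v w) i = (\<Sum>j<?n. C $$ (i, j) * v $ e j)"
      using C i by (simp add: w scalar_prod_def atLeast0LessThan)
    also have "\<dots> = (\<Sum>j<?n. A $ e i $ e j * v $ e j - (if i = j then l * v $ e i else 0))"
      using i by (intro sum.cong) (auto simp: C_ij algebra_simps)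
    also have "\<dots> = (\<Sum>j<?n. A $ e i $ e j * v $ e j) - l * v $ e i"
      using i by (simp add: sum_subtractf)
    also have "(\<Sum>j<?n. A $ e i $ e j * v $ e j) = (A *v v) $ e i"
      unfolding matrix_vector_mult_def
      using sum.reindex_bij_betw[OF e, of "\<lambda>j. A $ e i $ j * v $ j"] by simp
    finally show ?thesis .
  qed
  have x: "x \<in> mat_kernel C"
    by (rule mat_kernelI[OF C]) (auto intro!: eq_vecI simp: mulC[OF x_def] v0(1), simp_all add: x_def C carrier_matD[OF C])
  have ker: "\<exists>c. w = c \<cdot>\<^sub>v x" if w: "w \<in> mat_kernel C" for w
  proof -
    define v where "v = (\<chi> j. vec_index w (inv_into {..<?n} e j))"
    have wc: "w \<in> carrier_vec ?n" "C *\<^sub>v w = 0\<^sub>v ?n" using mat_kernelD[OF C w] by auto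
    have weq: "w = Matrix.vec ?n (\<lambda>i. v $ e i)"
      using wc e by (intro eq_vecI) (auto simp: v_def bij_betw_def inv_into_f_f)
    have "A *v v = l *s v" unfolding Finite_Cartesian_Product.vec_eq_iff
    proof
      fix k
      obtain i where i: "i < ?n" "k = e i" using e by (force simp: bij_betw_def)
      show "(A *v v) $ k = (l *s v) $ k" using mulC[OF weq i(1)] wc(2) i by simp
    qed
    then obtain c where "v = c *s v0" using v0(2) by blast
    then show ?thesis unfolding weq by (intro exI[of _ c] eq_vecI) (auto simp: x_def)
  qed
  have "mat_kernel C \<subseteq> K.Ker.span {x}"
  proof
    fix w assume "w \<in> mat_kernel C"
    then obtain c where c: "w = c \<cdot>\<^sub>v x" using ker by blast
    have "x \<in> K.Ker.span {x}" using K.Ker.in_own_span[of "{x}"] x by simp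
    then show "w \<in> K.Ker.span {x}"
      using submodule.smult_closed[OF K.Ker.span_is_submodule[of "{x}"], of c x] x
      by (simp add: c class_ring_simps)
  qed
  moreover have "K.Ker.span {x} \<subseteq> mat_kernel C"
    using K.Ker.span_is_subset2[of "{x}"] x by simp
  ultimately have "K.dim \<le> 1" by (intro K.Ker.dim_le1I[of x] x) auto
  then have "dim_gen_eigenspace ?B l 1 \<le> 1"
    using C by (simp add: dim_gen_eigenspace_def C_def[symmetric])
  \<comment> \<open>Block sizes are positive, so each block for \<open>l\<close> contributes
    \<open>min 1 k = 1\<close>.\<close>
  moreover have "dim_gen_eigenspace ?B l 1 = length (filter (\<lambda>b. snd b = l) bs)"
  proof -
    have "0 \<notin> fst ` set bs" using bs by (simp add: jordan_nf_def)
    then have "sum_list (map (min 1) (map fst (filter (\<lambda>(n, e). e = l) bs))) = length (filter (\<lambda>b. snd b = l) bs)"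
      by (induction bs) (auto simp: min_def)
    then show ?thesis unfolding dim_gen_eigenspace[OF bs] .
  qed
  ultimately show ?thesis by simp
qed

text \<open>The Segre characteristic forced by one-dimensional eigenspaces: a single block for each
  root, of size its multiplicity.\<close>

definition segre_of_poly :: "complex poly \<Rightarrow> nat multiset multiset" where
  "segre_of_poly p = image_mset (\<lambda>l. {#Polynomial.order l p#}) (mset_set {l. poly p l = 0})"

lemma size_segre_of_poly: "size (segre_of_poly p) = card {l. poly p l = 0}"
  by (simp add: segre_of_poly_def)

text \<open>The block sizes for \<open>l\<close> add up to the multiplicity of \<open>l\<close>; as
  there is only one block, the sum is its size.\<close>

lemma segre_of_blocks_char_poly:
  fixes A :: "complex ^ 'n ^ 'n::finite"
  assumes cyc: "cyclic_eigenspaces A" and e: "bij_betw e {..<CARD('n)} (UNIV :: 'n set)"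
    and bs: "jordan_nf (jnf_mat e A) bs"
  shows "segre_of_blocks bs = segre_of_poly (char_poly (jnf_mat e A))"
proof -
  let ?p = "char_poly (jnf_mat e A)"
  have p0: "?p \<noteq> 0" using degree_monic_char_poly[OF jnf_mat_carrier, of e A] by auto
  have ord: "Polynomial.order l ?p = sum_list (map fst (filter (\<lambda>b. snd b = l) bs))" for l
    by (rule jordan_nf_order[OF bs])
  have pos: "0 \<notin> fst ` set bs" using bs by (simp add: jordan_nf_def)
  have block: "map fst (filter (\<lambda>b. snd b = l) bs) = [Polynomial.order l ?p] \<and> Polynomial.order l ?p \<noteq> 0"
    if "l \<in> snd ` set bs" for l
  proof -
    have "filter (\<lambda>b. snd b = l) bs \<noteq> []" using that by (auto simp: filter_empty_conv)
    then obtain b where b: "filter (\<lambda>b. snd b = l) bs = [b]"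
      using one_jordan_block[OF cyc e bs, of l]
      by (cases "filter (\<lambda>b. snd b = l) bs") auto
    then have "b \<in> set (filter (\<lambda>b. snd b = l) bs)" by simp
    then have "fst b \<noteq> 0" using pos by (metis filter_is_subset imageI subsetD)
    then show ?thesis using ord[of l] by (simp add: b)
  qed
  have "snd ` set bs = {l. poly ?p l = 0}"
  proof (intro equalityI subsetI)
    fix l assume "l \<in> snd ` set bs"
    then show "l \<in> {l. poly ?p l = 0}" using block[of l] order_root[of ?p l] by auto
  next
    fix l assume "l \<in> {l. poly ?p l = 0}"
    then have "Polynomial.order l ?p \<noteq> 0" using p0 by (simp add: order_root)
    moreover have "filter (\<lambda>b. snd b = l) bs = []" if "l \<notin> snd ` set bs"
      using that by (auto simp: filter_empty_conv)
    ultimately show "l \<in> snd ` set bs" using ord[of l] by fastforce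
  qed
  then show ?thesis
    unfolding segre_of_blocks_def segre_of_poly_def
    using block poly_roots_finite[OF p0] by (auto intro!: image_mset_cong simp flip: mset_map)
qed

text \<open>A Jordan form exists because the characteristic polynomial splits over the complex
  numbers, and every Jordan form has the same Segre characteristic. Algebraic genericity thereby
  becomes a statement about polynomials.\<close>

lemma has_segre_characteristic_iff:
  fixes A :: "complex ^ 'n ^ 'n::finite"
  assumes cyc: "cyclic_eigenspaces A"
    and p: "\<And>e. bij_betw e {..<CARD('n)} (UNIV :: 'n set) \<Longrightarrow> char_poly (jnf_mat e A) = p"
  shows "has_segre_characteristic A S \<longleftrightarrow> S = segre_of_poly p"
proof
  assume "has_segre_characteristic A S"
  then show "S = segre_of_poly p"
    unfolding has_segre_characteristic_def has_jordan_form_def jnf_mat_def[symmetric]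
    using segre_of_blocks_char_poly[OF cyc] p by metis
next
  assume S: "S = segre_of_poly p"
  obtain e where e: "bij_betw e {..<CARD('n)} (UNIV :: 'n set)"
    using ex_bij_betw_nat_finite[of "UNIV :: 'n set"] by (auto simp: atLeast0LessThan)
  obtain as where "char_poly (jnf_mat e A) = (\<Prod>a\<leftarrow>as. [:- a, 1:])"
    using char_poly_factorized[OF jnf_mat_carrier, of e A] by blast
  then obtain bs where bs: "jordan_nf (jnf_mat e A) bs"
    using jordan_nf_exists[OF jnf_mat_carrier, of e A] by blast
  then have "has_jordan_form A bs"
    unfolding has_jordan_form_def jnf_mat_def[symmetric] using e by blast
  then show "has_segre_characteristic A S"
    unfolding has_segre_characteristic_def S using segre_of_blocks_char_poly[OF cyc e bs] p[OF e] by auto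
qed

section \<open>Characteristic polynomials depending on a point\<close>

text \<open>\<open>P y\<close> at \<open>f y\<close> is split into \<open>P x\<close> at
  \<open>f y\<close> and \<open>P y - P x\<close> at \<open>f y\<close>; the coefficients of the
  latter vanish at \<open>x\<close>. The polynomial \<open>D v\<close> collects the derivatives of
  the coefficients along \<open>v\<close>.\<close>

lemma has_derivative_poly:
  fixes f :: "'a::real_normed_vector \<Rightarrow> complex"
  assumes P: "\<And>j. ((\<lambda>y. Polynomial.coeff (P y) j) has_derivative (\<lambda>v. Polynomial.coeff (D v) j)) (at x)"
    and deg: "\<And>y. degree (P y) \<le> n" "\<And>v. degree (D v) \<le> n" and f: "(f has_derivative f') (at x)"
  shows "((\<lambda>y. poly (P y) (f y)) has_derivative
    (\<lambda>v. poly (pderiv (P x)) (f x) * f' v + poly (D v) (f x))) (at x)"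
proof -
  have "((\<lambda>y. poly (P x) (f y)) has_derivative (\<lambda>v. poly (pderiv (P x)) (f x) * f' v)) (at x)"
    using has_derivative_compose[OF f, of "poly (P x)"] poly_DERIV[of "P x" "f x"]
    by (simp add: has_field_derivative_def)
  moreover have "((\<lambda>y. \<Sum>i\<le>n. (Polynomial.coeff (P y) i - Polynomial.coeff (P x) i) * f y ^ i) has_derivative
      (\<lambda>v. \<Sum>i\<le>n. Polynomial.coeff (D v) i * f x ^ i)) (at x)"
  proof (intro has_derivative_sum has_derivative_mult_zero)
    fix i
    show "((\<lambda>y. Polynomial.coeff (P y) i - Polynomial.coeff (P x) i) has_derivative (\<lambda>v. Polynomial.coeff (D v) i)) (at x)"
      using has_derivative_diff[OF P has_derivative_const] by simp
    show "isCont (\<lambda>y. f y ^ i) x"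
      using has_derivative_continuous[OF f] by (intro continuous_intros)
  qed simp
  ultimately have "((\<lambda>y. poly (P x) (f y) + (\<Sum>i\<le>n. (Polynomial.coeff (P y) i - Polynomial.coeff (P x) i) * f y ^ i))
      has_derivative (\<lambda>v. poly (pderiv (P x)) (f x) * f' v + (\<Sum>i\<le>n. Polynomial.coeff (D v) i * f x ^ i))) (at x)"
    by (rule has_derivative_add)
  moreover have "poly (P x) (f y) + (\<Sum>i\<le>n. (Polynomial.coeff (P y) i - Polynomial.coeff (P x) i) * f y ^ i) = poly (P y) (f y)" for y
    unfolding poly_altdef_le[OF deg(1)] sum.distrib[symmetric] by (intro sum.cong) (auto simp: algebra_simps)
  ultimately show ?thesis unfolding poly_altdef_le[OF deg(2)] by simp
qed

text \<open>Differentiation in \<open>t\<close> commutes with differentiation of the coefficients in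
  the parameter. Taken for all \<open>k < m\<close>, the conclusions say that
  \<open>(t - f x) ^ m\<close> divides \<open>D v + f' v * pderiv (P x)\<close>.\<close>

lemma higher_pderiv_root_derivative:
  fixes f :: "'a::real_normed_vector \<Rightarrow> complex"
  assumes P: "\<And>j. ((\<lambda>y. Polynomial.coeff (P y) j) has_derivative (\<lambda>v. Polynomial.coeff (D v) j)) (at x)"
    and deg: "\<And>y. degree (P y) \<le> n" "\<And>v. degree (D v) \<le> n" and f: "(f has_derivative f') (at x)"
    and root: "eventually (\<lambda>y. poly ((pderiv ^^ k) (P y)) (f y) = 0) (nhds x)"
  shows "poly ((pderiv ^^ k) (D v + Polynomial.smult (f' v) (pderiv (P x)))) (f x) = 0"
proof -
  have co: "((\<lambda>y. Polynomial.coeff ((pderiv ^^ k) (P y)) j) has_derivative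
      (\<lambda>v. Polynomial.coeff ((pderiv ^^ k) (D v)) j)) (at x)" for j
  proof -
    obtain c where "\<And>p. Polynomial.coeff ((pderiv ^^ k) p) j = c * Polynomial.coeff (p :: complex poly) (k + j)"
      using coeff_higher_pderiv by blast
    then show ?thesis using has_derivative_mult_right[OF P, of c] by simp
  qed
  have "((\<lambda>y. poly ((pderiv ^^ k) (P y)) (f y)) has_derivative
      (\<lambda>v. poly (pderiv ((pderiv ^^ k) (P x))) (f x) * f' v + poly ((pderiv ^^ k) (D v)) (f x))) (at x)"
    using order_trans[OF degree_higher_pderiv_le deg(1)] order_trans[OF degree_higher_pderiv_le deg(2)]
    by (intro has_derivative_poly[OF co _ _ f])
  then have "((\<lambda>y. 0 :: complex) has_derivative
      (\<lambda>v. poly (pderiv ((pderiv ^^ k) (P x))) (f x) * f' v + poly ((pderiv ^^ k) (D v)) (f x))) (at x)"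
    using root has_derivative_transform_eventually[of _ _ x UNIV "\<lambda>y. 0"] eventually_nhds_x_imp_x[OF root]
    by (simp add: eventually_nhds_conv_at)
  then have "(\<lambda>v. poly (pderiv ((pderiv ^^ k) (P x))) (f x) * f' v + poly ((pderiv ^^ k) (D v)) (f x)) = (\<lambda>v. 0)"
    using has_derivative_unique has_derivative_const by blast
  then have *: "poly (pderiv ((pderiv ^^ k) (P x))) (f x) * f' v + poly ((pderiv ^^ k) (D v)) (f x) = 0"
    by (rule fun_cong)
  have "(pderiv ^^ k) (p + Polynomial.smult c q) = (pderiv ^^ k) p + Polynomial.smult c ((pderiv ^^ k) q)"
    for p q :: "complex poly" and c
    by (induction k) (auto simp: pderiv_add pderiv_smult)
  moreover have "(pderiv ^^ k) (pderiv p) = pderiv ((pderiv ^^ k) p)" for p :: "complex poly"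
    by (simp add: funpow_swap1)
  ultimately show ?thesis using * by (simp add: algebra_simps)
qed

section \<open>Expansion in the quotients of a polynomial by its linear factors\<close>

abbreviation root_cofactor :: "complex poly \<Rightarrow> complex \<Rightarrow> complex poly" where
  "root_cofactor p a \<equiv> p div [:-a, 1:]"

lemma root_cofactor: "poly p a = 0 \<Longrightarrow> p = [:-a, 1:] * root_cofactor p a"
  using dvd_mult_div_cancel[of "[:-a, 1:]" p] by (simp only: poly_eq_0_iff_dvd)

text \<open>This is the logarithmic derivative: division by \<open>p\<close> turns it into the sum
  of \<open>m_a / (t - a)\<close> over the roots.\<close>

lemma pderiv_root_cofactors:
  fixes p :: "complex poly"
  assumes "lead_coeff p = 1"
  shows "pderiv p = (\<Sum>a | poly p a = 0. Polynomial.smult (of_nat (Polynomial.order a p)) (root_cofactor p a))"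
proof -
  let ?Z = "{a. poly p a = 0}" and ?o = "\<lambda>a. Polynomial.order a p"
  have p0: "p \<noteq> 0" using assms by auto
  have p: "p = (\<Prod>a\<in>?Z. [:-a, 1:] ^ ?o a)" using complex_poly_decompose[of p] assms by simp
  have cof: "root_cofactor p a = [:-a, 1:] ^ (?o a - 1) * (\<Prod>b\<in>?Z - {a}. [:-b, 1:] ^ ?o b)" if "a \<in> ?Z" for a
  proof -
    have "?o a > 0" using that p0 by (simp add: order_gt_0_iff)
    then have pw: "[:-a, 1:] ^ ?o a = [:-a, 1:] * [:-a, 1:] ^ (?o a - 1)" by (cases "?o a") auto
    let ?W = "[:-a, 1:] ^ (?o a - 1) * (\<Prod>b\<in>?Z - {a}. [:-b, 1:] ^ ?o b)"
    have "(\<Prod>a\<in>?Z. [:-a, 1:] ^ ?o a) = [:-a, 1:] * ?W"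
      by (subst prod.remove[OF poly_roots_finite[OF p0] that]) (simp only: pw mult.assoc)
    from trans[OF p this] have "root_cofactor p a = ([:-a, 1:] * ?W) div [:-a, 1:]" by (rule arg_cong)
    also have "\<dots> = ?W" by (rule nonzero_mult_div_cancel_left) simp
    finally show ?thesis .
  qed
  have "pderiv p = pderiv (\<Prod>a\<in>?Z. [:-a, 1:] ^ ?o a)" using p by simp
  also have "\<dots> = (\<Sum>a\<in>?Z. (\<Prod>b\<in>?Z - {a}. [:-b, 1:] ^ ?o b) * pderiv ([:-a, 1:] ^ ?o a))"
    by (rule pderiv_prod)
  also have "\<dots> = (\<Sum>a\<in>?Z. Polynomial.smult (of_nat (?o a)) (root_cofactor p a))"
    by (intro sum.cong refl) (simp only: cof pderiv_power, simp add: pderiv_pCons algebra_simps)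
  finally show ?thesis .
qed

text \<open>The uniqueness half of Hermite interpolation: both sides have degree less than
  \<open>degree p\<close> and agree modulo each \<open>(t - a) ^ m_a\<close>. Modulo that power only
  the cofactor of \<open>a\<close> survives, on the right as well as in
  \<open>c a * pderiv p\<close>.\<close>

lemma eq_root_cofactor_sum:
  fixes p q :: "complex poly"
  assumes p: "lead_coeff p = 1" and q: "degree q < degree p"
    and dvd: "\<And>a. poly p a = 0 \<Longrightarrow> [:-a, 1:] ^ Polynomial.order a p dvd q - Polynomial.smult (c a) (pderiv p)"
  shows "q = (\<Sum>a | poly p a = 0. Polynomial.smult (of_nat (Polynomial.order a p) * c a) (root_cofactor p a))"
proof -
  let ?Z = "{a. poly p a = 0}" and ?o = "\<lambda>a. Polynomial.order a p"
  have p0: "p \<noteq> 0" using p by auto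
  note fin = poly_roots_finite[OF p0]
  define r where "r = (\<Sum>a\<in>?Z. Polynomial.smult (of_nat (?o a) * c a) (root_cofactor p a))"
  have deg: "degree (root_cofactor p a) < degree p" if "a \<in> ?Z" for a
  proof -
    have "root_cofactor p a \<noteq> 0" using root_cofactor[of p a] that p0 by fastforce
    then have "degree ([:-a, 1:] * root_cofactor p a) = Suc (degree (root_cofactor p a))"
      by (subst degree_mult_eq) auto
    then show ?thesis using root_cofactor[of p a] that by simp
  qed
  have "degree r < degree p"
    unfolding r_def
  proof (rule degree_sum_less)
    show "degree (Polynomial.smult (of_nat (?o a) * c a) (root_cofactor p a)) < degree p" if "a \<in> ?Z" for a
      using deg[OF that] degree_smult_le le_less_trans by blast
  qed (use q in auto)
  then have deg_diff: "degree (q - r) < degree p" using q degree_diff_le_max[of q r] by simp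
  have dvd': "[:-a, 1:] ^ ?o a dvd q - r" if a: "a \<in> ?Z" for a
  proof -
    \<comment> \<open>The weights arise from \<open>c a * pderiv p - r\<close>. For
      \<open>b = a\<close> the weight is zero, and for other \<open>b\<close> the cofactor keeps the
      full multiplicity of \<open>a\<close>.\<close>
    have "[:-a, 1:] ^ ?o a dvd Polynomial.smult (of_nat (?o b) * (c a - c b)) (root_cofactor p b)" if "b \<in> ?Z" for b
    proof (cases "a = b")
      case False
      have eq: "p = [:-b, 1:] * root_cofactor p b" using root_cofactor[of p b] that by simp
      have "Polynomial.order a ([:-b, 1:] * root_cofactor p b)
          = Polynomial.order a [:-b, 1:] + Polynomial.order a (root_cofactor p b)"
        by (rule order_mult) (use eq p0 in metis)
      then have "?o a = Polynomial.order a [:-b, 1:] + Polynomial.order a (root_cofactor p b)"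
        by (simp only: eq[symmetric])
      moreover have "Polynomial.order a [:-b, 1:] = 0" using False by (intro order_0I) simp
      ultimately have "[:-a, 1:] ^ ?o a dvd root_cofactor p b" by (simp add: order_1)
      then show ?thesis by (rule dvd_smult)
    qed simp
    then have "[:-a, 1:] ^ ?o a dvd (\<Sum>b\<in>?Z. Polynomial.smult (of_nat (?o b) * (c a - c b)) (root_cofactor p b))"
      by (rule dvd_sum)
    also have "\<dots> = Polynomial.smult (c a) (pderiv p) - r"
      unfolding pderiv_root_cofactors[OF p] r_def smult_sum2 sum_subtractf[symmetric]
      by (intro sum.cong refl) (simp add: smult_diff_left algebra_simps)
    finally have "[:-a, 1:] ^ ?o a dvd (q - Polynomial.smult (c a) (pderiv p)) + (Polynomial.smult (c a) (pderiv p) - r)"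
      using dvd a by (intro dvd_add) auto
    then show ?thesis by simp
  qed
  have "q - r = 0"
  proof (rule ccontr)
    assume ne: "q - r \<noteq> 0"
    have le: "?o a \<le> Polynomial.order a (q - r)" if "a \<in> ?Z" for a
      using dvd'[OF that] ne by (simp add: order_divides)
    have sub: "?Z \<subseteq> {a. poly (q - r) a = 0}"
    proof
      fix a assume a: "a \<in> ?Z"
      then have "?o a > 0" using p0 by (simp add: order_gt_0_iff)
      then show "a \<in> {a. poly (q - r) a = 0}" using le[OF a] order_root[of "q - r" a] by auto
    qed
    \<comment> \<open>A nonzero \<open>q - r\<close> would have at least \<open>degree p\<close>
      roots, counted with multiplicity.\<close>
    have "degree p = (\<Sum>a\<in>?Z. ?o a)" by (rule sum_order_roots[OF p0, symmetric])
    also have "\<dots> \<le> (\<Sum>a\<in>?Z. Polynomial.order a (q - r))" by (rule sum_mono[OF le])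
    also have "\<dots> \<le> (\<Sum>a | poly (q - r) a = 0. Polynomial.order a (q - r))"
      using sub poly_roots_finite[OF ne] by (intro sum_mono2) auto
    also have "\<dots> = degree (q - r)" by (rule sum_order_roots[OF ne])
    finally show False using deg_diff by simp
  qed
  then show ?thesis by (simp add: r_def)
qed

section \<open>Complexified covectors\<close>

text \<open>The formula of \<open>complex_differential\<close> detached from charts, so that it
  applies both to the derivatives of the real coefficients and to those of the branches.\<close>

definition complex_ext :: "(real ^ 'n \<Rightarrow> complex) \<Rightarrow> complex ^ 'n::finite \<Rightarrow> complex" where
  "complex_ext d v = d (\<chi> i. Re (v $ i)) + \<i> * d (\<chi> i. Im (v $ i))"

lemma complex_ext_linear:
  assumes "linear d"
  shows complex_ext_add: "complex_ext d (v + w) = complex_ext d v + complex_ext d w"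
    and complex_ext_scale: "complex_ext d (c *s v) = c * complex_ext d v"
proof -
  interpret linear d by fact
  have "(\<chi> i. Re ((v + w) $ i)) = (\<chi> i. Re (v $ i)) + (\<chi> i. Re (w $ i))"
    "(\<chi> i. Im ((v + w) $ i)) = (\<chi> i. Im (v $ i)) + (\<chi> i. Im (w $ i))"
    by (simp_all add: Finite_Cartesian_Product.vec_eq_iff)
  then show "complex_ext d (v + w) = complex_ext d v + complex_ext d w"
    by (simp add: complex_ext_def add algebra_simps)
  have sc: "d (r *\<^sub>R x) = of_real r * d x" for r x
    unfolding scale by (rule scaleR_conv_of_real)
  have "(\<chi> i. Re ((c *s v) $ i)) = Re c *\<^sub>R (\<chi> i. Re (v $ i)) - Im c *\<^sub>R (\<chi> i. Im (v $ i))"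
    "(\<chi> i. Im ((c *s v) $ i)) = Re c *\<^sub>R (\<chi> i. Im (v $ i)) + Im c *\<^sub>R (\<chi> i. Re (v $ i))"
    by (simp_all add: Finite_Cartesian_Product.vec_eq_iff)
  then have "complex_ext d (c *s v) = of_real (Re c) * d (\<chi> i. Re (v $ i)) - of_real (Im c) * d (\<chi> i. Im (v $ i))
      + \<i> * (of_real (Re c) * d (\<chi> i. Im (v $ i)) + of_real (Im c) * d (\<chi> i. Re (v $ i)))"
    by (simp only: complex_ext_def add diff sc)
  also have "\<dots> = (of_real (Re c) + \<i> * of_real (Im c)) * complex_ext d v"
    by (simp add: complex_ext_def algebra_simps)
  also have "of_real (Re c) + \<i> * of_real (Im c) = c" using complex_eq[of c] by simp
  finally show "complex_ext d (c *s v) = c * complex_ext d v" .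
qed

lemma complex_ext_0: "linear d \<Longrightarrow> complex_ext d 0 = 0"
  using complex_ext_scale[of d 0 0] by simp

lemma complex_ext_vsum:
  "linear d \<Longrightarrow> complex_ext d (\<Sum>i\<in>I. f i) = (\<Sum>i\<in>I. complex_ext d (f i))"
  by (induction I rule: infinite_finite_induct) (auto simp: complex_ext_0 complex_ext_add)

lemma complex_ext_sum:
  "complex_ext (\<lambda>\<eta>. \<Sum>i\<in>I. c i * d i \<eta>) v = (\<Sum>i\<in>I. c i * complex_ext (d i) v)"
  by (simp add: complex_ext_def sum_distrib_left sum.distrib algebra_simps)

lemma Re_funpow_complexify: "(\<chi> i. Re (((*v) (complexify A) ^^ k) v $ i)) = ((*v) A ^^ k) (\<chi> i. Re (v $ i))"
  by (induction k) (simp_all add: Finite_Cartesian_Product.vec_eq_iff matrix_vector_mult_def map_matrix_def)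

lemma Im_funpow_complexify: "(\<chi> i. Im (((*v) (complexify A) ^^ k) v $ i)) = ((*v) A ^^ k) (\<chi> i. Im (v $ i))"
  by (induction k) (simp_all add: Finite_Cartesian_Product.vec_eq_iff matrix_vector_mult_def map_matrix_def)

lemma dual_op_funpow: "(dual_op A ^^ k) \<alpha> \<xi> = \<alpha> (((*v) A ^^ k) \<xi>)"
proof (induction k arbitrary: \<xi>)
  case (Suc k)
  have "(dual_op A ^^ Suc k) \<alpha> \<xi> = (dual_op A ^^ k) \<alpha> (A *v \<xi>)" by (simp add: dual_op_def)
  also have "\<dots> = \<alpha> (((*v) A ^^ Suc k) \<xi>)" by (simp add: Suc funpow_swap1)
  finally show ?case .
qed simp

section \<open>The covector at a point of constant multiplicities\<close>

text \<open>The equivalence at a single point, in coordinates and with the branches \<open>L\<close>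
  given. Both directions rest on a formula for the covector in which every summand is some
  \<open>dL a\<close> applied to an eigenvector for \<open>a\<close>.\<close>

lemma covector_eq_0_iff_eigenvalue_derivatives:
  fixes s :: "nat \<Rightarrow> real ^ 'n::finite \<Rightarrow> real" and A :: "real ^ 'n ^ 'n"
  defines "P \<equiv> \<lambda>y. char_poly_of CARD('n) (\<lambda>i. s i y)"
  assumes V: "open V" "x \<in> V"
    and s: "\<And>i. i \<in> {1..CARD('n)} \<Longrightarrow> (s i has_derivative ds i) (at x)"
    and char: "\<And>t. char_poly_at A t = t ^ CARD('n) - (\<Sum>i=1..CARD('n). s i x * t ^ (CARD('n) - i))"
    and cyc: "cyclic_eigenspaces (complexify A)"
    and L: "\<And>a. poly (P x) a = 0 \<Longrightarrow> L a x = a"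
      "\<And>a. poly (P x) a = 0 \<Longrightarrow> (L a has_derivative dL a) (at x)"
      "\<And>a y. poly (P x) a = 0 \<Longrightarrow> y \<in> V \<Longrightarrow> Polynomial.order (L a y) (P y) = Polynomial.order a (P x)"
  shows "(\<forall>\<xi>. (\<Sum>i=1..CARD('n). (dual_op A ^^ (CARD('n) - i)) (ds i) \<xi>) = 0) \<longleftrightarrow>
    (\<forall>a. poly (P x) a = 0 \<longrightarrow> (\<forall>v\<in>eigenspace_of (complexify A) a. complex_ext (dL a) v = 0))"
proof -
  let ?n = "CARD('n)" and ?A = "complexify A" and ?Z = "{a. poly (P x) a = 0}"
  let ?m = "\<lambda>a. Polynomial.order a (P x)" and ?Q = "root_cofactor (P x)"
  have P: "degree (P y) = ?n" "lead_coeff (P y) = 1" for y by (simp_all add: P_def coeff_char_poly_of)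
  have P0: "P y \<noteq> 0" for y using P(2)[of y] by auto
  note fin = poly_roots_finite[OF P0[of x]]
  obtain e where e: "bij_betw e {..<?n} (UNIV :: 'n set)"
    using ex_bij_betw_nat_finite[of "UNIV :: 'n set"] by (auto simp: atLeast0LessThan)
  have charP: "char_poly (jnf_mat e ?A) = P x"
    unfolding P_def by (rule char_poly_jnf_mat[OF e char])
  have CH: "matrix_poly_apply ?A (P x) v = 0" for v
    using Cayley_Hamilton[OF e, of ?A v] by (simp add: charP)

  define D where "D v = (\<Sum>i=1..?n. monom (complex_of_real (ds i v)) (?n - i))" for v
  have coeff_D: "Polynomial.coeff (D v) j = (if j < ?n then of_real (ds (?n - j) v) else 0)" for v j
  proof -
    have "D v = monom 1 ?n - char_poly_of ?n (\<lambda>i. ds i v)" by (simp add: D_def char_poly_of_def)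
    then show ?thesis by (simp add: coeff_char_poly_of)
  qed
  have deg_D: "degree (D v) < ?n" for v
    by (rule degree_lessI) (auto simp: coeff_D)
  have dP: "((\<lambda>y. Polynomial.coeff (P y) j) has_derivative (\<lambda>v. Polynomial.coeff (- D v) j)) (at x)" for j
  proof (cases "j < ?n")
    case True
    then have "(s (?n - j) has_derivative ds (?n - j)) (at x)" by (intro s) auto
    then have "((\<lambda>y. - complex_of_real (s (?n - j) y)) has_derivative (\<lambda>v. - complex_of_real (ds (?n - j) v))) (at x)"
      by (intro has_derivative_minus bounded_linear.has_derivative[OF bounded_linear_of_real])
    with True show ?thesis by (simp add: P_def coeff_char_poly_of coeff_D)
  next
    case False
    then show ?thesis by (cases "j = ?n") (auto simp: P_def coeff_char_poly_of coeff_D)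
  qed
  have dvd: "[:-a, 1:] ^ ?m a dvd D v - Polynomial.smult (dL a v) (pderiv (P x))" if a: "poly (P x) a = 0" for a v
  proof -
    have "[:-a, 1:] ^ ?m a dvd - D v + Polynomial.smult (dL a v) (pderiv (P x))"
    proof (rule linear_power_dvdI)
      fix k assume k: "k < ?m a"
      \<comment> \<open>The order is constant along the branch, so the lower derivatives vanish on a
        whole neighbourhood and the relation may be differentiated.\<close>
      have ev: "eventually (\<lambda>y. poly ((pderiv ^^ k) (P y)) (L a y) = 0) (nhds x)"
        using eventually_nhds_in_open[OF V]
        by (rule eventually_mono) (use higher_pderiv_order(1)[OF P0] L(3)[OF a] k in auto)
      show "poly ((pderiv ^^ k) (- D v + Polynomial.smult (dL a v) (pderiv (P x)))) a = 0"
        using higher_pderiv_root_derivative[OF dP _ _ L(2)[OF a] ev, of ?n v] P(1) deg_D L(1)[OF a]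
        by (simp add: less_imp_le)
    qed
    then have "[:-a, 1:] ^ ?m a dvd - (- D v + Polynomial.smult (dL a v) (pderiv (P x)))"
      by (simp only: dvd_minus_iff)
    then show ?thesis by simp
  qed
  \<comment> \<open>the formula \<open>d\<chi>(t) = - \<Sum>a. m\<^sub>a (\<chi>(t) / (t - a)) da\<close>, with \<open>D = - d\<chi>\<close>\<close>
  have "D v = (\<Sum>a\<in>?Z. Polynomial.smult (of_nat (?m a) * dL a v) (?Q a))" for v
    by (rule eq_root_cofactor_sum[OF P(2) _ dvd]) (simp add: P(1) deg_D)
  then have "Polynomial.coeff (D v) j = (\<Sum>a\<in>?Z. (of_nat (?m a) * Polynomial.coeff (?Q a) j) * dL a v)" for v j
    by (simp add: coeff_sum algebra_simps)
  \<comment> \<open>Substituting the matrix for \<open>t\<close> pairs the coefficient of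
    \<open>t ^ j\<close> with the \<open>j\<close>-th iterate of the matrix on \<open>v\<close>, so
    each \<open>ds i\<close> is evaluated at a different vector. The identity is therefore used
    coefficient by coefficient.\<close>
  then have ds: "of_real (ds i v) = (\<Sum>a\<in>?Z. (of_nat (?m a) * Polynomial.coeff (?Q a) (?n - i)) * dL a v)"
    if "i \<in> {1..?n}" for i v
    using coeff_D[of v "?n - i"] that by simp

  have linL: "linear (dL a)" if "a \<in> ?Z" for a
    using L(2) that has_derivative_linear by blast
  \<comment> \<open>The covector on complex vectors: the eigenvectors
    \<open>matrix_poly_apply ?A (?Q a) v\<close> need not be real.\<close>
  define \<alpha> where "\<alpha> v = (\<Sum>i=1..?n. complex_ext (\<lambda>\<eta>. of_real (ds i \<eta>)) (((*v) ?A ^^ (?n - i)) v))" for v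
  have \<alpha>_Re_Im: "\<alpha> v = of_real (\<Sum>i=1..?n. (dual_op A ^^ (?n - i)) (ds i) (\<chi> i. Re (v $ i)))
      + \<i> * of_real (\<Sum>i=1..?n. (dual_op A ^^ (?n - i)) (ds i) (\<chi> i. Im (v $ i)))" for v
    by (simp add: \<alpha>_def complex_ext_def Re_funpow_complexify Im_funpow_complexify dual_op_funpow
        sum.distrib sum_distrib_left)
  have 1: "(\<forall>\<xi>. (\<Sum>i=1..?n. (dual_op A ^^ (?n - i)) (ds i) \<xi>) = 0) \<longleftrightarrow> (\<forall>v. \<alpha> v = 0)"
  proof
    assume \<alpha>: "\<forall>v. \<alpha> v = 0"
    show "\<forall>\<xi>. (\<Sum>i=1..?n. (dual_op A ^^ (?n - i)) (ds i) \<xi>) = 0"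
    proof
      fix \<xi>
      \<comment> \<open>At the real vector \<open>\<xi>\<close>, seen as a complex one, the real
        part of \<open>\<alpha>\<close> is the original covector.\<close>
      show "(\<Sum>i=1..?n. (dual_op A ^^ (?n - i)) (ds i) \<xi>) = 0"
        using arg_cong[OF \<alpha>[rule_format, of "\<chi> i. of_real (\<xi> $ i)"], of Re] unfolding \<alpha>_Re_Im
        by simp
    qed
  qed (simp add: \<alpha>_Re_Im)
  have \<alpha>: "\<alpha> v = (\<Sum>a\<in>?Z. of_nat (?m a) * complex_ext (dL a) (matrix_poly_apply ?A (?Q a) v))" for v
  proof -
    have "\<alpha> v = (\<Sum>i=1..?n. \<Sum>a\<in>?Z. (of_nat (?m a) * Polynomial.coeff (?Q a) (?n - i)) *
        complex_ext (dL a) (((*v) ?A ^^ (?n - i)) v))"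
      unfolding \<alpha>_def complex_ext_sum[symmetric]
    proof (rule sum.cong[OF refl])
      fix i assume i: "i \<in> {1..?n}"
      show "complex_ext (\<lambda>\<eta>. complex_of_real (ds i \<eta>)) (((*v) ?A ^^ (?n - i)) v) =
          complex_ext (\<lambda>\<eta>. \<Sum>a\<in>?Z. (of_nat (?m a) * Polynomial.coeff (?Q a) (?n - i)) * dL a \<eta>) (((*v) ?A ^^ (?n - i)) v)"
        by (simp only: ds[OF i])
    qed
    also have "\<dots> = (\<Sum>a\<in>?Z. of_nat (?m a) * (\<Sum>i=1..?n. Polynomial.coeff (?Q a) (?n - i) *
        complex_ext (dL a) (((*v) ?A ^^ (?n - i)) v)))"
      by (subst sum.swap) (simp only: sum_distrib_left mult.assoc)
    also have "\<dots> = (\<Sum>a\<in>?Z. of_nat (?m a) * complex_ext (dL a) (matrix_poly_apply ?A (?Q a) v))"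
    proof (intro sum.cong refl arg_cong2[where f = "(*)"])
      fix a assume a: "a \<in> ?Z"
      have "degree ([:-a, 1:] * ?Q a) = Suc (degree (?Q a))"
        using root_cofactor[of "P x" a] a P0[of x] by (subst degree_mult_eq) auto
      then have deg: "degree (?Q a) \<le> ?n - 1"
        using root_cofactor[of "P x" a] a P(1)[of x] by simp
      have "(\<Sum>i=1..?n. Polynomial.coeff (?Q a) (?n - i) * complex_ext (dL a) (((*v) ?A ^^ (?n - i)) v))
          = (\<Sum>i\<le>?n - 1. Polynomial.coeff (?Q a) i * complex_ext (dL a) (((*v) ?A ^^ i) v))"
        by (rule sum.reindex_bij_witness[of _ "\<lambda>i. ?n - i" "\<lambda>i. ?n - i"])
          (auto, use zero_less_card_finite[where 'a = 'n] in linarith)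
      also have "\<dots> = complex_ext (dL a) (matrix_poly_apply ?A (?Q a) v)"
        using linL[OF a] unfolding matrix_poly_apply_le[OF deg]
        by (simp add: complex_ext_vsum complex_ext_scale)
      finally show "(\<Sum>i=1..?n. Polynomial.coeff (?Q a) (?n - i) * complex_ext (dL a) (((*v) ?A ^^ (?n - i)) v))
          = complex_ext (dL a) (matrix_poly_apply ?A (?Q a) v)" .
    qed
    finally show ?thesis .
  qed
  have eig: "?A *v matrix_poly_apply ?A (?Q a) v = a *s matrix_poly_apply ?A (?Q a) v" if "a \<in> ?Z" for a v
  proof -
    have "matrix_poly_apply ?A ([:-a, 1:] * ?Q a) v = 0"
      using CH[of v] root_cofactor[of "P x" a] that by simp
    then show ?thesis by (simp only: matrix_poly_apply_mult linear_poly_apply right_minus_eq)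
  qed
  have "(\<forall>v. \<alpha> v = 0) \<longleftrightarrow> (\<forall>a\<in>?Z. \<forall>v\<in>eigenspace_of ?A a. complex_ext (dL a) v = 0)"
  proof
    assume "\<forall>a\<in>?Z. \<forall>v\<in>eigenspace_of ?A a. complex_ext (dL a) v = 0"
    then show "\<forall>v. \<alpha> v = 0" using eig by (simp add: \<alpha> eigenspace_of_def)
  next
    assume \<alpha>0: "\<forall>v. \<alpha> v = 0"
    show "\<forall>a\<in>?Z. \<forall>v\<in>eigenspace_of ?A a. complex_ext (dL a) v = 0"
    proof (intro ballI)
      fix a v assume a: "a \<in> ?Z" and v: "v \<in> eigenspace_of ?A a"
      have Qa: "P x = [:-a, 1:] * ?Q a" using root_cofactor a by blast
      have Qa0: "?Q a \<noteq> 0" using Qa P0[of x] by fastforce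
      have "degree ([:-a, 1:] * ?Q a) = Suc (degree (?Q a))"
        using Qa0 by (subst degree_mult_eq) auto
      then have "degree (?Q a) < ?n" using Qa P(1)[of x] by simp
      then obtain u where u: "matrix_poly_apply ?A (?Q a) u \<noteq> 0"
        using ex_matrix_poly_apply_nonzero[OF cyc Qa0] by blast
      define w where "w = matrix_poly_apply ?A (?Q a) u"
      define R where "R = (\<Prod>b\<in>?Z - {a}. [:-b, 1:])"
      \<comment> \<open>Polynomials in the same matrix commute, and \<open>R\<close> acts on an
        eigenvector for \<open>b\<close> as the number \<open>poly R b\<close>.\<close>
      have QR: "matrix_poly_apply ?A (?Q b) (matrix_poly_apply ?A R u) = poly R b *s matrix_poly_apply ?A (?Q b) u"
        if "b \<in> ?Z" for b
        by (subst matrix_poly_apply_commute) (rule matrix_poly_apply_eigenvector[OF eig[OF that]])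
      have Rb: "poly R b = 0" if "b \<in> ?Z - {a}" for b
        using that fin unfolding R_def poly_prod by (intro prod_zero bexI[of _ b]) auto
      have Ra: "poly R a \<noteq> 0"
        using fin unfolding R_def poly_prod by (subst prod_zero_iff) auto
      have "0 = \<alpha> (matrix_poly_apply ?A R u)" using \<alpha>0 by simp
      also have "\<dots> = (\<Sum>b\<in>?Z. of_nat (?m b) * complex_ext (dL b) (poly R b *s matrix_poly_apply ?A (?Q b) u))"
        unfolding \<alpha> by (intro sum.cong refl) (simp only: QR)
      also have "\<dots> = of_nat (?m a) * complex_ext (dL a) (poly R a *s w)"
        using Rb fin a linL by (subst sum.remove[OF _ a]) (auto intro!: sum.neutral simp: w_def complex_ext_0)
      also have "\<dots> = of_nat (?m a) * poly R a * complex_ext (dL a) w"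
        using linL[OF a] by (simp add: complex_ext_scale)
      finally have "complex_ext (dL a) w = 0"
        using Ra order_gt_0_iff[OF P0[of x], of a] a by auto
      \<comment> \<open>A nonzero vector in an eigenspace that is at most a line generates
        it.\<close>
      moreover have "\<exists>c. v = c *s w"
      proof -
        obtain v0 where v0: "\<forall>v\<in>eigenspace_of ?A a. \<exists>c. v = c *s v0"
          using cyc unfolding cyclic_eigenspaces_def by blast
        have "w \<in> eigenspace_of ?A a" using eig[OF a] by (simp add: eigenspace_of_def w_def)
        then obtain c where c: "w = c *s v0" using v0 by blast
        have "c \<noteq> 0" using u c unfolding w_def by auto
        then have "v0 = inverse c *s w" by (simp add: c vector_smult_assoc)
        then show ?thesis using v0 v vector_smult_assoc by metis
      qed
      ultimately show "complex_ext (dL a) v = 0" using complex_ext_scale[OF linL[OF a]] by auto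
    qed
  qed
  with 1 show ?thesis by simp
qed

section \<open>Smoothness of the coefficients of the characteristic polynomial\<close>

lemma smooth_on_coeff_prod:
  fixes f :: "'i \<Rightarrow> 'a::euclidean_space \<Rightarrow> real poly"
  assumes "open U" "\<And>i k. i \<in> I \<Longrightarrow> smooth_on U (\<lambda>y. Polynomial.coeff (f i y) k)"
  shows "smooth_on U (\<lambda>y. Polynomial.coeff (\<Prod>i\<in>I. f i y) k)"
  using assms(2)
proof (induction I arbitrary: k rule: infinite_finite_induct)
  case (insert i I)
  have "smooth_on U (\<lambda>y. \<Sum>j\<le>k. Polynomial.coeff (f i y) j * Polynomial.coeff (\<Prod>i\<in>I. f i y) (k - j))"
    using insert.prems by (intro smooth_on_sum smooth_on_mult assms(1) insert.IH) auto
  then show ?case using insert.hyps by (simp add: coeff_mult)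
qed (simp_all add: smooth_on_const)

text \<open>\<open>char_poly_at\<close> is a mere function of \<open>t\<close>. Its coefficients are
  recovered from the determinant of a matrix of polynomials, where they are visibly polynomial
  expressions in the entries of \<open>A y\<close>.\<close>

lemma smooth_on_char_poly_coeff:
  fixes A :: "'a::euclidean_space \<Rightarrow> real ^ 'n ^ 'n::finite"
  assumes "open U" "smooth_on U A" and i: "i \<in> {1..CARD('n)}"
    and char: "\<And>y t. y \<in> U \<Longrightarrow> char_poly_at (A y) t = t ^ CARD('n) - (\<Sum>i=1..CARD('n). s i y * t ^ (CARD('n) - i))"
  shows "smooth_on U (s i)"
proof -
  let ?n = "CARD('n)"
  define M where "M y = (\<chi> j k. [:- (A y $ j $ k), if j = k then 1 else 0:])" for y
  have detM: "poly (Determinants.det (M y)) t = char_poly_at (A y) t" for y t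
    unfolding char_poly_at_def Determinants.det_def
    by (auto simp: poly_sum poly_prod M_def Finite_Cartesian_Product.mat_def intro!: sum.cong prod.cong)
  have smA: "smooth_on U (\<lambda>y. A y $ j $ k)" for j k
  proof (rule smooth_on_bounded_linear[OF _ assms(1,2)])
    show "bounded_linear (\<lambda>B :: real ^ 'n ^ 'n. B $ j $ k)"
      by (rule bounded_linear_compose[OF bounded_linear_vec_nth bounded_linear_vec_nth])
  qed
  have "smooth_on U (\<lambda>y. Polynomial.coeff (M y $ j $ k) l)" for j k l
  proof -
    have "smooth_on U (\<lambda>y. (- 1) * (A y $ j $ k))"
      by (intro smooth_on_mult smooth_on_const assms(1) smA)
    moreover have "Polynomial.coeff (M y $ j $ k) l =
        (if l = 0 then - 1 * (A y $ j $ k) else if l = 1 \<and> j = k then 1 else 0)" for y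
      by (auto simp: M_def coeff_pCons split: nat.split)
    ultimately show ?thesis by (cases "l = 0") (simp_all add: smooth_on_const)
  qed
  then have "smooth_on U (\<lambda>y. \<Sum>p | p permutes (UNIV :: 'n set). of_int (sign p) *
      Polynomial.coeff (\<Prod>j\<in>UNIV. M y $ j $ p j) (?n - i))"
    by (intro smooth_on_sum smooth_on_mult smooth_on_const smooth_on_coeff_prod assms(1))
  moreover have "Polynomial.coeff (of_int k * q) l = of_int k * Polynomial.coeff q l" for k l and q :: "real poly"
    by (simp add: of_int_poly)
  ultimately have sm: "smooth_on U (\<lambda>y. Polynomial.coeff (Determinants.det (M y)) (?n - i))"
    by (simp add: Determinants.det_def coeff_sum)
  have "s i y = (- 1) * Polynomial.coeff (Determinants.det (M y)) (?n - i)" if y: "y \<in> U" for y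
  proof -
    define q where "q = monom 1 ?n - (\<Sum>i=1..?n. monom (s i y) (?n - i))"
    have "poly q t = poly (Determinants.det (M y)) t" for t
      unfolding detM char[OF y] by (simp add: q_def poly_monom poly_sum)
    then have eq: "q = Determinants.det (M y)" using poly_eq_poly_eq_iff[of q "Determinants.det (M y)"] by auto
    have "(\<Sum>j=1..?n. Polynomial.coeff (monom (s j y) (?n - j)) (?n - i)) = (\<Sum>j=1..?n. if j = i then s i y else 0)"
      using i by (intro sum.cong) auto
    moreover have "?n - i < ?n" by (rule diff_less) (use i in auto)
    then have "?n \<noteq> ?n - i" by linarith
    ultimately have "Polynomial.coeff q (?n - i) = - s i y"
      using i by (simp add: q_def coeff_sum)
    with eq show ?thesis by simp
  qed
  then show ?thesis
    using smooth_on_cong[OF assms(1) _ smooth_on_mult[OF assms(1) smooth_on_const[of U "- 1"] sm], where g = "s i"]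
    by simp
qed

section \<open>Globalization\<close>

text \<open>Distinct roots of the limit have disjoint neighbourhoods, each of which still contains a
  root of \<open>Q x\<close>: roots may split, but not merge.\<close>

lemma eventually_card_roots_ge:
  fixes Q :: "'x \<Rightarrow> complex poly"
  assumes co: "\<And>i. ((\<lambda>x. Polynomial.coeff (Q x) i) \<longlongrightarrow> Polynomial.coeff p i) F"
    and Q: "\<And>x. degree (Q x) = n" "\<And>x. lead_coeff (Q x) = 1" and p: "degree p \<le> n" "p \<noteq> 0"
  shows "eventually (\<lambda>x. card {z. poly p z = 0} \<le> card {z. poly (Q x) z = 0}) F"
proof -
  let ?Z = "{z. poly p z = 0}"
  have fin: "finite ?Z" using p(2) by (rule poly_roots_finite)
  obtain s where s: "s > 0" "\<And>a b. a \<in> ?Z \<Longrightarrow> b \<in> ?Z \<Longrightarrow> a \<noteq> b \<Longrightarrow> 2 * s \<le> dist a b"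
    using finite_separated[OF fin] by blast
  have "eventually (\<lambda>x. \<forall>a\<in>?Z. \<exists>z. dist z a < s \<and> poly (Q x) z = 0) F"
    by (intro eventually_ball_finite fin ballI eventually_root_near[OF co Q]) (use p s in auto)
  then show ?thesis
  proof eventually_elim
    case (elim x)
    then obtain g where g: "\<And>a. a \<in> ?Z \<Longrightarrow> dist (g a) a < s" "\<And>a. a \<in> ?Z \<Longrightarrow> poly (Q x) (g a) = 0"
      by metis
    have "inj_on g ?Z"
    proof (rule inj_onI, rule ccontr)
      fix a b assume ab: "a \<in> ?Z" "b \<in> ?Z" "g a = g b" "a \<noteq> b"
      have "dist a b \<le> dist (g a) a + dist (g b) b"
        using ab(3) dist_triangle2[of a b "g a"] by (simp add: dist_commute)
      then show False using g(1)[OF ab(1)] g(1)[OF ab(2)] s(2)[OF ab(1,2,4)] by simp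
    qed
    moreover have "g ` ?Z \<subseteq> {z. poly (Q x) z = 0}" using g(2) by auto
    moreover have "finite {z. poly (Q x) z = 0}" using Q(2)[of x] by (intro poly_roots_finite) auto
    ultimately show ?case by (metis card_image card_mono)
  qed
qed

lemma segre_of_poly_bij:
  assumes "bij_betw g {z. poly p z = 0} {z. poly q z = 0}"
    and "\<And>a. poly p a = 0 \<Longrightarrow> Polynomial.order (g a) q = Polynomial.order a p" and "p \<noteq> 0"
  shows "segre_of_poly q = segre_of_poly p"
proof -
  have "mset_set {z. poly q z = 0} = image_mset g (mset_set {z. poly p z = 0})"
    using assms(1) by (simp add: bij_betw_def image_mset_mset_set)
  then have "segre_of_poly q = image_mset (\<lambda>a. {#Polynomial.order (g a) q#}) (mset_set {z. poly p z = 0})"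
    by (simp add: segre_of_poly_def multiset.map_comp o_def)
  also have "\<dots> = segre_of_poly p"
    unfolding segre_of_poly_def using assms(2) poly_roots_finite[OF assms(3)] by (intro image_mset_cong) auto
  finally show ?thesis .
qed

section \<open>Charts\<close>

lemma is_chart_properties:
  assumes c: "is_chart M c"
  shows is_chart_inv: "q \<in> fst c \<Longrightarrow> inv_into (fst c) (snd c) (snd c q) = q"
    and is_chart_subset: "fst c \<subseteq> topspace M"
    and is_chart_open_image: "openin M W \<Longrightarrow> open (snd c ` (fst c \<inter> W))"
    and is_chart_open_vimage: "open V \<Longrightarrow> openin M {q \<in> fst c. snd c q \<in> V}"
proof -
  have op: "openin M (fst c)" and U: "open (snd c ` fst c)"
    and h: "homeomorphic_map (subtopology M (fst c)) (top_of_set (snd c ` fst c)) (snd c)"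
    using c by (auto simp: is_chart_def)
  show sub: "fst c \<subseteq> topspace M" using op by (rule openin_subset)
  then have top: "topspace (subtopology M (fst c)) = fst c" by auto
  have inj: "inj_on (snd c) (fst c)" using homeomorphic_imp_injective_map[OF h] top by simp
  show "q \<in> fst c \<Longrightarrow> inv_into (fst c) (snd c) (snd c q) = q" using inj by simp
  show "open (snd c ` (fst c \<inter> W))" if W: "openin M W"
  proof -
    have "openin (subtopology M (fst c)) (fst c \<inter> W)" using W by (metis inf_commute openin_subtopology_Int)
    then have "openin (top_of_set (snd c ` fst c)) (snd c ` (fst c \<inter> W))"
      using homeomorphic_imp_open_map[OF h] by (simp add: open_map_def)
    then show ?thesis using U by (rule openin_open_trans)
  qed
  show "openin M {q \<in> fst c. snd c q \<in> V}" if V: "open V"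
  proof -
    have "openin (top_of_set (snd c ` fst c)) (snd c ` fst c \<inter> V)" using V by (simp add: openin_open_Int)
    then have "openin (subtopology M (fst c)) {q \<in> topspace (subtopology M (fst c)). snd c q \<in> snd c ` fst c \<inter> V}"
      using homeomorphic_imp_continuous_map[OF h] openin_continuous_map_preimage by blast
    then have "openin (subtopology M (fst c)) {q \<in> fst c. snd c q \<in> V}"
      unfolding top by (rule back_subst[of "openin _"]) auto
    then show ?thesis using op openin_trans_full by blast
  qed
qed

section \<open>Continuity of the covector in a chart\<close>

lemma continuous_on_funpow_matrix:
  fixes A :: "'a::topological_space \<Rightarrow> real ^ 'n ^ 'n::finite"
  assumes "continuous_on U A"
  shows "continuous_on U (\<lambda>y. ((*v) (A y) ^^ k) \<xi>)"
proof (induction k)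
  case (Suc k)
  then have "continuous_on U (\<lambda>y. \<chi> i. \<Sum>j\<in>UNIV. A y $ i $ j * ((*v) (A y) ^^ k) \<xi> $ j)"
    using assms by (intro continuous_intros)
  moreover have "((*v) (A y) ^^ Suc k) \<xi> = (\<chi> i. \<Sum>j\<in>UNIV. A y $ i $ j * ((*v) (A y) ^^ k) \<xi> $ j)" for y
    unfolding funpow.simps o_apply by (rule meta_eq_to_obj_eq[OF matrix_vector_mult_def])
  ultimately show ?case by (simp only:)
qed simp

text \<open>Smoothness gives continuity of the derivative along a fixed vector; as the direction
  \<open>g y\<close> varies too, it is expanded in the standard basis.\<close>

lemma continuous_on_frechet_derivative_apply:
  fixes f :: "real ^ 'n::finite \<Rightarrow> real"
  assumes "smooth_on U f" "continuous_on U g"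
  shows "continuous_on U (\<lambda>y. frechet_derivative f (at y) (g y))"
proof -
  have eq: "frechet_derivative f (at y) (g y) = (\<Sum>j\<in>UNIV. g y $ j * frechet_derivative f (at y) (axis j 1))"
    if "y \<in> U" for y
  proof -
    interpret linear "frechet_derivative f (at y)"
      using smooth_on_has_derivative[OF assms(1) that] by (rule has_derivative_linear)
    have "g y = (\<Sum>j\<in>UNIV. g y $ j *\<^sub>R axis j 1)"
      using basis_expansion[of "g y"] by (simp add: scalar_mult_eq_scaleR)
    then have "frechet_derivative f (at y) (g y) = frechet_derivative f (at y) (\<Sum>j\<in>UNIV. g y $ j *\<^sub>R axis j 1)"
      by simp
    then show ?thesis by (simp add: sum scale)
  qed
  have "continuous_on U (\<lambda>y. \<Sum>j\<in>UNIV. g y $ j * frechet_derivative f (at y) (axis j 1))"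
    using assms smooth_on_imp_continuous_on[OF smooth_on_frechet_derivative[OF assms(1)]]
    by (intro continuous_intros)
  moreover have "continuous_on U (\<lambda>y. frechet_derivative f (at y) (g y)) \<longleftrightarrow>
      continuous_on U (\<lambda>y. \<Sum>j\<in>UNIV. g y $ j * frechet_derivative f (at y) (axis j 1))"
    by (intro continuous_on_cong refl eq)
  ultimately show ?thesis by simp
qed

text \<open>\<open>frechet_derivative\<close> is a choice from the relation
  \<open>has_derivative\<close>, which depends only on the germ at \<open>x\<close>, so the equality
  holds even where no derivative exists.\<close>

lemma frechet_derivative_eventually_eq:
  assumes "eventually (\<lambda>y. f y = g y) (nhds x)"
  shows "frechet_derivative f (at x) = frechet_derivative g (at x)"
proof -
  have "(f has_derivative D) (at x) \<longleftrightarrow> (g has_derivative D) (at x)" for D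
  proof
    show "(f has_derivative D) (at x) \<Longrightarrow> (g has_derivative D) (at x)"
      using has_derivative_transform_eventually[of f D x UNIV g] assms eventually_nhds_x_imp_x[OF assms]
      by (simp add: eventually_nhds_conv_at)
    have "eventually (\<lambda>y. g y = f y) (nhds x)" using assms by (simp add: eq_commute)
    then show "(g has_derivative D) (at x) \<Longrightarrow> (f has_derivative D) (at x)"
      using has_derivative_transform_eventually[of g D x UNIV f] eventually_nhds_x_imp_x
      by (fastforce simp: eventually_nhds_conv_at)
  qed
  then show ?thesis by (simp add: frechet_derivative_def)
qed

theorem theorem1p2:
  fixes M :: "'a topology"
    and \<A> :: "('a, 'n::finite) chart set"
    and K :: "('a, 'n) tensor_field11"
    and \<sigma> :: "nat \<Rightarrow> 'a \<Rightarrow> real"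
  assumes "smooth_manifold M \<A>"
    and "smooth_tensor_field11 \<A> K"
    and "gl_regular M \<A> K"
    and "\<forall>p\<in>topspace M. \<forall>c\<in>charts_at \<A> p. \<forall>t.
           char_poly_at (K c p) t =
             t ^ CARD('n) - (\<Sum>i=1..CARD('n). \<sigma> i p * t ^ (CARD('n) - i))"
  shows "weakly_nonlinear_at_generic_points M \<A> K \<longleftrightarrow>
    (\<forall>p\<in>topspace M. \<forall>c\<in>charts_at \<A> p. \<forall>\<xi>.
       (\<Sum>i=1..CARD('n). (dual_op (K c p) ^^ (CARD('n) - i)) (differential c (\<sigma> i) p) \<xi>) = 0)"
proof -
  let ?n = "CARD('n)"
  \<comment> \<open>Chart independence is built in: the same \<open>\<sigma> i\<close> serve all
    charts at a point.\<close>
  define Pm where "Pm q = char_poly_of ?n (\<lambda>i. \<sigma> i q)" for q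
  have Pm: "degree (Pm q) = ?n" "lead_coeff (Pm q) = 1" for q
    by (simp_all add: Pm_def coeff_char_poly_of)
  have Pm0: "Pm q \<noteq> 0" for q using Pm(2)[of q] by auto
  let ?psi = "\<lambda>c :: ('a, 'n) chart. inv_into (fst c) (snd c)"
  have chart: "is_chart M c" if "c \<in> \<A>" for c
    using assms(1) that by (simp add: smooth_manifold_def)
  have psi_in: "?psi c y \<in> fst c" "snd c (?psi c y) = y" if "y \<in> snd c ` fst c" for c y
    using that by (auto simp: inv_into_into f_inv_into_f)
  have charts_at: "c \<in> charts_at \<A> q" "q \<in> topspace M" if "c \<in> \<A>" "q \<in> fst c" for c q
    using that is_chart_subset[OF chart[OF that(1)]] by (auto simp: charts_at_def)
  have openU: "open (snd c ` fst c)" if "c \<in> \<A>" for c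
    using chart[OF that] by (simp add: is_chart_def)
  have char: "char_poly_at (K c q) t = t ^ ?n - (\<Sum>i=1..?n. \<sigma> i q * t ^ (?n - i))"
    if "c \<in> \<A>" "q \<in> fst c" for c q t
    using assms(4) charts_at[OF that] by blast
  have cyc: "cyclic_eigenspaces (complexify (K c q))" if "c \<in> \<A>" "q \<in> fst c" for c q
    using assms(3) charts_at[OF that] by (intro cyclic_eigenspacesI) (auto simp: gl_regular_def)
  have charP: "char_poly (jnf_mat e (complexify (K c q))) = Pm q"
    if "c \<in> \<A>" "q \<in> fst c" "bij_betw e {..<?n} (UNIV :: 'n set)" for c q e
    unfolding Pm_def by (rule char_poly_jnf_mat[OF that(3) char[OF that(1,2)]])
  have eigenvalue_iff: "l \<in> eigenvalues_of (complexify (K c q)) \<longleftrightarrow> poly (Pm q) l = 0"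
    if "c \<in> \<A>" "q \<in> fst c" for c q l
  proof -
    obtain e where e: "bij_betw e {..<?n} (UNIV :: 'n set)"
      using ex_bij_betw_nat_finite[of "UNIV :: 'n set"] by (auto simp: atLeast0LessThan)
    show ?thesis using eigenvalues_of_iff_poly[OF e] charP[OF that e] by simp
  qed
  have segre_iff: "has_segre_characteristic (complexify (K c q)) S \<longleftrightarrow> S = segre_of_poly (Pm q)"
    if "c \<in> \<A>" "q \<in> fst c" for c q S
    by (rule has_segre_characteristic_iff[OF cyc[OF that] charP[OF that]])

  define s where "s c i = coord_repr c (\<sigma> i)" for c :: "('a, 'n) chart" and i
  define P where "P c y = char_poly_of ?n (\<lambda>i. s c i y)" for c :: "('a, 'n) chart" and y
  have P_Pm: "P c y = Pm (?psi c y)" for c y by (simp add: P_def Pm_def s_def coord_repr_def)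
  have P: "degree (P c y) = ?n" "lead_coeff (P c y) = 1" for c y unfolding P_Pm by (rule Pm)+
  have P0: "P c y \<noteq> 0" for c y by (simp add: P_Pm Pm0)
  have P_chart: "P c (snd c q) = Pm q" if "c \<in> \<A>" "q \<in> fst c" for c q
    using is_chart_inv[OF chart[OF that(1)] that(2)] by (simp add: P_Pm)
  have smK: "smooth_on (snd c ` fst c) (\<lambda>y. K c (?psi c y))" if "c \<in> \<A>" for c
    using assms(2) that by (simp add: smooth_tensor_field11_def coord_repr_def o_def)
  have sms: "smooth_on (snd c ` fst c) (s c i)" if "c \<in> \<A>" "i \<in> {1..?n}" for c i
    by (rule smooth_on_char_poly_coeff[OF openU smK])
      (use that char psi_in in \<open>auto simp: s_def coord_repr_def\<close>)
  have smP: "smooth_on (snd c ` fst c) (\<lambda>y. Polynomial.coeff (P c y) j)" if "c \<in> \<A>" for c j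
  proof -
    consider "j < ?n" | "\<not> j < ?n" by blast
    then show ?thesis
    proof cases
      case 1
      then have "smooth_on (snd c ` fst c) (\<lambda>y. complex_of_real (s c (?n - j) y))"
        by (intro smooth_on_bounded_linear[OF bounded_linear_of_real openU sms] that) auto
      then have "smooth_on (snd c ` fst c) (\<lambda>y. - 1 * complex_of_real (s c (?n - j) y))"
        by (intro smooth_on_mult smooth_on_const openU that)
      with 1 show ?thesis by (simp add: P_def coeff_char_poly_of)
    next
      case 2
      then have "Polynomial.coeff (P c y) j = (if j = ?n then 1 else 0)" for y
        by (simp add: P_def coeff_char_poly_of)
      then show ?thesis by (simp only: smooth_on_const)
    qed
  qed
  have coP: "((\<lambda>y. Polynomial.coeff (P c y) j) \<longlongrightarrow> Polynomial.coeff (P c x) j) (nhds x)"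
    if "c \<in> \<A>" "x \<in> snd c ` fst c" for c x j
  proof -
    have "isCont (\<lambda>y. Polynomial.coeff (P c y) j) x"
      using smooth_on_imp_continuous_on[OF smP[OF that(1)]] openU[OF that(1)] that(2)
        continuous_on_eq_continuous_at by blast
    then show ?thesis unfolding isCont_def using tendsto_at_iff_tendsto_nhds by fastforce
  qed
  \<comment> \<open>Local constancy of the number of distinct eigenvalues, read in a chart;
    \<open>generic_const\<close> and \<open>main\<close> together show that it amounts to algebraic
    genericity.\<close>
  define const_card where "const_card c x \<longleftrightarrow>
      eventually (\<lambda>y. card {z. poly (P c y) z = 0} = card {z. poly (P c x) z = 0}) (nhds x)" for c x

  have generic_const: "const_card c (snd c p)"
    if p: "algebraically_generic M \<A> K p" and c: "c \<in> \<A>" "p \<in> fst c" for p c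
  proof -
    obtain W S where W: "openin M W" "p \<in> W"
      "\<And>q c. q \<in> W \<Longrightarrow> c \<in> charts_at \<A> q \<Longrightarrow> has_segre_characteristic (complexify (K c q)) S"
      using p unfolding algebraically_generic_def by blast
    \<comment> \<open>The Segre characteristic has one element per eigenvalue, so its size counts
      the distinct eigenvalues.\<close>
    have card: "card {z. poly (P c (snd c q)) z = 0} = size S" if "q \<in> fst c" "q \<in> W" for q
      using W(3)[OF that(2) charts_at(1)[OF c(1) that(1)]] segre_iff[OF c(1) that(1)]
      by (simp add: P_chart[OF c(1) that(1)] size_segre_of_poly)
    have "eventually (\<lambda>y. y \<in> snd c ` (fst c \<inter> W)) (nhds (snd c p))"
      by (rule eventually_nhds_in_open[OF is_chart_open_image[OF chart[OF c(1)] W(1)]]) (use c W(2) in auto)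
    then show ?thesis
      unfolding const_card_def by (rule eventually_mono) (use card c(2) W(2) in auto)
  qed

  \<comment> \<open>The three conclusions share the branches \<open>L\<close>. The second feeds a
    branch to the hypothesis of weak nonlinearity; the third compares a given eigenvalue function
    with a branch.\<close>
  have main: "algebraically_generic M \<A> K p \<and>
      (weakly_nonlinear_at_generic_points M \<A> K \<longrightarrow>
        (\<forall>\<xi>. (\<Sum>i=1..?n. (dual_op (K c p) ^^ (?n - i)) (differential c (\<sigma> i) p) \<xi>) = 0)) \<and>
      ((\<forall>\<xi>. (\<Sum>i=1..?n. (dual_op (K c p) ^^ (?n - i)) (differential c (\<sigma> i) p) \<xi>) = 0) \<longrightarrow>
        (\<forall>W l. openin M W \<and> p \<in> W \<and> smooth_eigenvalue_on \<A> K W l \<longrightarrow>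
           (\<forall>v\<in>eigenspace_of (complexify (K c p)) (l p). complex_differential c l p v = 0)))"
    if c: "c \<in> \<A>" "p \<in> fst c" and const: "const_card c (snd c p)" for c p
  proof -
    define x where "x = snd c p"
    let ?U = "snd c ` fst c"
    have xU: "x \<in> ?U" using c by (auto simp: x_def)
    have px: "?psi c x = p" unfolding x_def by (rule is_chart_inv[OF chart[OF c(1)] c(2)])
    obtain V L d where V: "open V" "x \<in> V" "V \<subseteq> ?U" "d > 0"
      and L: "\<And>a. poly (P c x) a = 0 \<Longrightarrow> L a x = a"
        "\<And>a. poly (P c x) a = 0 \<Longrightarrow> smooth_on V (L a)"
        "\<And>y. y \<in> V \<Longrightarrow> bij_betw (\<lambda>a. L a y) {a. poly (P c x) a = 0} {a. poly (P c y) a = 0}"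
        "\<And>y a. y \<in> V \<Longrightarrow> poly (P c x) a = 0 \<Longrightarrow> Polynomial.order (L a y) (P c y) = Polynomial.order a (P c x)"
        "\<And>y a z. y \<in> V \<Longrightarrow> poly (P c x) a = 0 \<Longrightarrow> poly (P c y) z = 0 \<Longrightarrow> dist z a < d \<Longrightarrow> z = L a y"
      by (rule root_branches[OF openU[OF c(1)] xU smP[OF c(1)] P const[unfolded const_card_def, folded x_def]])
        (rule that)
    define W0 where "W0 = {q \<in> fst c. snd c q \<in> V}"
    have W0: "openin M W0" "p \<in> W0"
      unfolding W0_def using is_chart_open_vimage[OF chart[OF c(1)] V(1)] c(2) V(2) by (auto simp: x_def)
    have evV: "eventually (\<lambda>y. y \<in> V) (nhds x)" using V by (simp add: eventually_nhds_in_open)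

    have generic: "algebraically_generic M \<A> K p"
      unfolding algebraically_generic_def
    proof (intro exI conjI ballI)
      fix q c' assume q: "q \<in> W0" and c': "c' \<in> charts_at \<A> q"
      have "segre_of_poly (P c (snd c q)) = segre_of_poly (P c x)"
        by (rule segre_of_poly_bij[OF L(3) L(4) P0]) (use q in \<open>auto simp: W0_def\<close>)
      then have "segre_of_poly (P c x) = segre_of_poly (Pm q)"
        using q P_chart[OF c(1)] by (simp add: W0_def)
      then show "has_segre_characteristic (complexify (K c' q)) (segre_of_poly (P c x))"
        using segre_iff c' by (simp add: charts_at_def)
    qed (use W0 in auto)

    define dL where "dL a = frechet_derivative (L a) (at x)" for a
    have eq: "(\<forall>\<xi>. (\<Sum>i=1..?n. (dual_op (K c p) ^^ (?n - i)) (differential c (\<sigma> i) p) \<xi>) = 0) \<longleftrightarrow>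
        (\<forall>a. poly (P c x) a = 0 \<longrightarrow> (\<forall>v\<in>eigenspace_of (complexify (K c p)) a. complex_ext (dL a) v = 0))"
      unfolding P_def
    proof (rule covector_eq_0_iff_eigenvalue_derivatives[OF V(1,2), where L = L])
      show "(s c i has_derivative differential c (\<sigma> i) p) (at x)" if "i \<in> {1..?n}" for i
        using smooth_on_has_derivative[OF sms[OF c(1) that] xU] by (simp add: differential_def x_def s_def)
      show "char_poly_at (K c p) t = t ^ ?n - (\<Sum>i=1..?n. s c i x * t ^ (?n - i))" for t
        using char[OF c] px by (simp add: s_def coord_repr_def)
      show "(L a has_derivative dL a) (at x)" if "poly (char_poly_of ?n (\<lambda>i. s c i x)) a = 0" for a
        unfolding dL_def by (rule smooth_on_has_derivative[OF L(2) V(2)]) (use that in \<open>simp add: P_def\<close>)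
    qed (use cyc[OF c] L(1,4) in \<open>simp_all add: P_def\<close>)

    have nl: "\<forall>\<xi>. (\<Sum>i=1..?n. (dual_op (K c p) ^^ (?n - i)) (differential c (\<sigma> i) p) \<xi>) = 0"
      if wn: "weakly_nonlinear_at_generic_points M \<A> K"
      unfolding eq
    proof (intro allI impI ballI)
      fix a v assume a: "poly (P c x) a = 0" and v: "v \<in> eigenspace_of (complexify (K c p)) a"
      \<comment> \<open>The branch through \<open>a\<close>, carried to \<open>W0\<close>, becomes
        one of the eigenvalue functions that weak nonlinearity quantifies over.\<close>
      define l where "l q = L a (snd c q)" for q
      have lp: "l p = a" using L(1)[OF a] by (simp add: l_def x_def)
      have order_l: "Polynomial.order (l q) (Pm q) = Polynomial.order a (P c x)" if "q \<in> W0" for q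
        using L(4)[OF _ a, of "snd c q"] that P_chart[OF c(1)] by (simp add: W0_def l_def)
      have order_pos: "Polynomial.order a (P c x) > 0" using a P0 by (simp add: order_gt_0_iff)
      \<comment> \<open>In another chart \<open>c'\<close> the transition map supplies continuity of
        \<open>l\<close>; smoothness then follows from its constant order as a root of
        \<open>P c'\<close>.\<close>
      have "smooth_on (snd c' ` (fst c' \<inter> W0)) (coord_repr c' l)" if c': "c' \<in> \<A>" for c'
      proof (rule root_of_constant_order_smooth_on[where P = "P c'" and n = ?n and m = "Polynomial.order a (P c x)"])
        let ?S = "snd c' ` (fst c' \<inter> W0)"
        show S: "open ?S" by (rule is_chart_open_image[OF chart[OF c'] W0(1)])
        have psi': "?psi c' (snd c' q) = q" if "q \<in> fst c'" for q
          by (rule is_chart_inv[OF chart[OF c'] that])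
        show "smooth_on ?S (\<lambda>y. Polynomial.coeff (P c' y) i)" for i
          by (rule smooth_on_subset[OF smP[OF c']]) auto
        have "smooth_on (snd c' ` (fst c' \<inter> fst c)) (transition c' c)"
          using assms(1) c(1) c' by (simp add: smooth_manifold_def)
        then have "continuous_on ?S (transition c' c)"
          by (rule continuous_on_subset[OF smooth_on_imp_continuous_on]) (auto simp: W0_def)
        moreover have "transition c' c ` ?S \<subseteq> V"
          using psi' by (auto simp: transition_def coord_repr_def W0_def)
        ultimately have "continuous_on ?S (\<lambda>y. L a (transition c' c y))"
          using continuous_on_compose2[OF smooth_on_imp_continuous_on[OF L(2)[OF a]]] by blast
        then show "continuous_on ?S (coord_repr c' l)"
          by (simp add: transition_def coord_repr_def l_def o_def)
        show "Polynomial.order (coord_repr c' l y) (P c' y) = Polynomial.order a (P c x)" if "y \<in> ?S" for y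
          using that order_l psi' by (auto simp: coord_repr_def P_Pm)
      qed (use P order_pos in auto)
      moreover have "l q \<in> eigenvalues_of (complexify (K c' q))" if "q \<in> W0" "c' \<in> charts_at \<A> q" for q c'
        using order_l[OF that(1)] order_pos order_root[of "Pm q" "l q"] eigenvalue_iff[of c' q "l q"] that(2)
        by (simp add: charts_at_def)
      ultimately have "smooth_eigenvalue_on \<A> K W0 l"
        by (simp add: smooth_eigenvalue_on_def smooth_fun_on_def)
      then have "complex_differential c l p v = 0"
        using wn generic W0 v lp charts_at[OF c] unfolding weakly_nonlinear_at_generic_points_def by blast
      moreover have "eventually (\<lambda>y. coord_repr c l y = L a y) (nhds x)"
        using evV by (rule eventually_mono) (use V(3) psi_in(2)[of _ c] in \<open>auto simp: coord_repr_def l_def\<close>)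
      then have "differential c l p = dL a"
        unfolding differential_def dL_def x_def[symmetric] by (rule frechet_derivative_eventually_eq)
      ultimately show "complex_ext (dL a) v = 0"
        by (simp add: complex_differential_def complex_ext_def)
    qed

    have wn: "complex_differential c l p v = 0"
      if \<alpha>: "\<forall>\<xi>. (\<Sum>i=1..?n. (dual_op (K c p) ^^ (?n - i)) (differential c (\<sigma> i) p) \<xi>) = 0"
        and W: "openin M W" "p \<in> W" and l: "smooth_eigenvalue_on \<A> K W l"
        and v: "v \<in> eigenspace_of (complexify (K c p)) (l p)" for W l v
    proof -
      let ?S = "snd c ` (fst c \<inter> W)"
      have S: "open ?S" "x \<in> ?S"
        using is_chart_open_image[OF chart[OF c(1)] W(1)] c(2) W(2) by (auto simp: x_def)
      have lP: "poly (Pm q) (l q) = 0" if "q \<in> W" "q \<in> fst c" for q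
        using l that charts_at[OF c(1) that(2)] eigenvalue_iff[OF c(1) that(2)]
        unfolding smooth_eigenvalue_on_def by blast
      have a: "poly (P c x) (l p) = 0" using lP[OF W(2) c(2)] px by (simp add: P_Pm)
      have lx: "coord_repr c l x = l p" using px by (simp add: coord_repr_def)
      have "smooth_on ?S (coord_repr c l)"
        using l c(1) by (simp add: smooth_eigenvalue_on_def smooth_fun_on_def)
      then have "isCont (coord_repr c l) x"
        using smooth_on_imp_continuous_on S continuous_on_eq_continuous_at by blast
      then have "(coord_repr c l \<longlongrightarrow> l p) (nhds x)"
        using tendsto_at_iff_tendsto_nhds[of "coord_repr c l" x] by (simp add: isCont_def lx)
      then have "eventually (\<lambda>y. dist (coord_repr c l y) (l p) < d) (nhds x)"
        using V(4) by (rule tendstoD)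
      moreover have "eventually (\<lambda>y. y \<in> ?S) (nhds x)" using S by (rule eventually_nhds_in_open)
      \<comment> \<open>By continuity the given eigenvalue function stays within \<open>d\<close> of
        \<open>l p\<close> near \<open>x\<close>, where the branch is the only root; both thus have
        the same derivative at \<open>x\<close>.\<close>
      ultimately have "eventually (\<lambda>y. coord_repr c l y = L (l p) y) (nhds x)"
        using evV
      proof eventually_elim
        case (elim y)
        have "poly (P c y) (coord_repr c l y) = 0"
          using elim(2) lP is_chart_inv[OF chart[OF c(1)]] by (auto simp: P_Pm coord_repr_def)
        then show ?case by (rule L(5)[OF elim(3) a _ elim(1)])
      qed
      then have "differential c l p = dL (l p)"
        unfolding differential_def dL_def x_def[symmetric] by (rule frechet_derivative_eventually_eq)
      moreover have "complex_ext (dL (l p)) v = 0" using \<alpha> eq a v by blast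
      ultimately show ?thesis by (simp add: complex_differential_def complex_ext_def)
    qed
    show ?thesis using generic nl wn by blast
  qed

  show ?thesis
  proof
    assume wn: "weakly_nonlinear_at_generic_points M \<A> K"
    show "\<forall>p\<in>topspace M. \<forall>c\<in>charts_at \<A> p. \<forall>\<xi>.
       (\<Sum>i=1..?n. (dual_op (K c p) ^^ (?n - i)) (differential c (\<sigma> i) p) \<xi>) = 0"
    proof (intro ballI allI, rule ccontr)
      fix p c \<xi>
      assume "c \<in> charts_at \<A> p"
      then have c: "c \<in> \<A>" "p \<in> fst c" by (auto simp: charts_at_def)
      let ?U = "snd c ` fst c"
      \<comment> \<open>the covector in the chart \<open>c\<close>; where it is nonzero, a point with the maximal number of
        eigenvalues would be algebraically generic\<close>
      define f where "f y = (\<Sum>i=1..?n. frechet_derivative (s c i) (at y) (((*v) (K c (?psi c y)) ^^ (?n - i)) \<xi>))" for y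
      have f_eq: "f (snd c q) = (\<Sum>i=1..?n. (dual_op (K c q) ^^ (?n - i)) (differential c (\<sigma> i) q) \<xi>)"
        if "q \<in> fst c" for q
        using is_chart_inv[OF chart[OF c(1)] that] by (simp add: f_def dual_op_funpow differential_def s_def)
      have "continuous_on ?U f"
        unfolding f_def
        by (intro continuous_on_sum continuous_on_frechet_derivative_apply continuous_on_funpow_matrix
            sms c(1) smooth_on_imp_continuous_on[OF smK])
      then have open_ne: "open {y \<in> ?U. f y \<noteq> 0}"
        using openU[OF c(1)] continuous_open_preimage[of ?U f "- {0}"] open_Compl[OF closed_singleton[of "0 :: real"]] by (simp add: vimage_def Int_def)
      assume "(\<Sum>i=1..?n. (dual_op (K c p) ^^ (?n - i)) (differential c (\<sigma> i) p) \<xi>) \<noteq> 0"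
      then have p: "snd c p \<in> {y \<in> ?U. f y \<noteq> 0}" using f_eq c(2) by simp
      \<comment> \<open>Bounded natural numbers attain a maximum on any nonempty set; the bound is
        the degree.\<close>
      have bound: "card {z. poly (P c y) z = 0} < Suc ?n" for y
        using poly_roots_degree[OF P0[of c y]] P(1)[of c y] by simp
      obtain y where y: "y \<in> {y \<in> ?U. f y \<noteq> 0}"
        and max: "\<And>y'. y' \<in> {y \<in> ?U. f y \<noteq> 0} \<Longrightarrow> card {z. poly (P c y') z = 0} \<le> card {z. poly (P c y) z = 0}"
        using ex_has_greatest_nat[of "\<lambda>y. y \<in> {y \<in> ?U. f y \<noteq> 0}" _ "\<lambda>y. card {z. poly (P c y) z = 0}" "Suc ?n"] p bound
        by blast
      have "eventually (\<lambda>y'. card {z. poly (P c y) z = 0} \<le> card {z. poly (P c y') z = 0}) (nhds y)"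
        by (rule eventually_card_roots_ge[OF coP P]) (use c(1) y P(1) P0 in auto)
      moreover have "eventually (\<lambda>y'. y' \<in> {y \<in> ?U. f y \<noteq> 0}) (nhds y)"
        by (rule eventually_nhds_in_open[OF open_ne y])
      \<comment> \<open>Semicontinuity gives one inequality near \<open>y\<close>, and maximality on
        the open set gives the other.\<close>
      ultimately have "const_card c y"
        unfolding const_card_def by eventually_elim (use max in \<open>auto intro: antisym\<close>)
      then have "f y = 0"
        using main[OF c(1) psi_in(1)] wn y psi_in[of y c] f_eq[of "?psi c y"] by auto
      then show False using y by simp
    qed
  next
    assume \<alpha>: "\<forall>p\<in>topspace M. \<forall>c\<in>charts_at \<A> p. \<forall>\<xi>.
       (\<Sum>i=1..?n. (dual_op (K c p) ^^ (?n - i)) (differential c (\<sigma> i) p) \<xi>) = 0"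
    show "weakly_nonlinear_at_generic_points M \<A> K"
      unfolding weakly_nonlinear_at_generic_points_def
    proof (intro ballI impI allI)
      fix p W l c v
      assume p: "p \<in> topspace M" "algebraically_generic M \<A> K p"
        and W: "openin M W \<and> p \<in> W \<and> smooth_eigenvalue_on \<A> K W l"
        and c: "c \<in> charts_at \<A> p" and v: "v \<in> eigenspace_of (complexify (K c p)) (l p)"
      have c': "c \<in> \<A>" "p \<in> fst c" using c by (auto simp: charts_at_def)
      show "complex_differential c l p v = 0"
        using main[OF c' generic_const[OF p(2) c']] \<alpha> p(1) c W v by blast
    qed
  qed
qed

end
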